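(* If $a$ is a non-negative integer, then $$\mathcal{U}_a(q)= \sum_{t=0}^a w_t(a)\sum_{\substack {\alpha, \beta, \gamma\geq 0\\ \alpha+2\beta+3\gamma=t}}c(\alpha,\beta,\gamma)\, E_2(q)^{\alpha} E_4(q)^{\beta} E_6(q)^{\gamma}.$$
   Context: For a positive integer $a$, $$\mathcal{U}_a(q):=\sum_{0< k_1<k_2<\cdots<k_a} \frac{q^{k_1+k_2+\cdots+k_a}}{(1-q^{k_1})^2(1-q^{k_2})^2\cdots(1-q^{k_a})^2}$$ as a formal power series in $q$, and $\mathcal{U}_0(q)=1$. With $\sigma_\nu(n):=\sum_{d\mid n}d^\nu$, the Eisenstein series are $$E_2(q):=1-24\sum_{n\geq1}\sigma_1(n)q^n,\quad E_4(q):=1+240\sum_{n\geq1}\sigma_3(n)q^n,\quad E_6(q):=1-504\sum_{n\geq1}\sigma_5(n)q^n.$$ The rational numbers $c(\alpha,\beta,\gamma)$ are defined by $c(0,0,0):=1$, $c(\alpha,\beta,\gamma):=0$ if any argument is negative, and for all other $\alpha,\beta,\gamma\geq0$ by the recursion $$c(\alpha,\beta,\gamma):=-\tfrac13(2\alpha+8\beta+12\gamma+1)\,c(\alpha-1,\beta,\gamma)+\tfrac23(\alpha+1)\,c(\alpha+1,\beta-1,\gamma)+\tfrac83(\beta+1)\,c(\alpha,\beta+1,\gamma-1)+4(\gamma+1)\,c(\alpha,\beta-2,\gamma+1).$$ For $0\leq t\leq a$, $$w_t(a):=\frac{\binom{2a}{a}}{16^a(2a+1)} \sum_{0\leq \ell_1<\cdots<\ell_t<a}\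 \prod_{j=1}^t\frac1{(2\ell_j+1)^2},$$ where for $t=0$ the sum is $1$. *)

theory Defs
  imports
    "HOL-Computational_Algebra.Formal_Power_Series"
    "HOL-Analysis.Infinite_Sum"
begin

text \<open>
  A strictly increasing index tuple is represented by the set of its entries.  The explicit
  finiteness condition matters for \<open>a = 0\<close>, because infinite sets have cardinality \<open>0\<close>.
\<close>
definition macmahon_index :: "nat \<Rightarrow> nat set set" where
  "macmahon_index a = {K. finite K \<and> card K = a \<and> (\<forall>k\<in>K. 0 < k)}"

definition macmahon_term :: "nat set \<Rightarrow> rat fps" where
  "macmahon_term K = fps_X ^ (\<Sum>k\<in>K. k) / (\<Prod>k\<in>K. (1 - fps_X ^ k)\<^sup>2)"

text \<open>
  The sum is taken in the coefficientwise topology on formal power series; it converges for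
  every \<open>a\<close>, see \<open>macmahon_summable\<close> below.
\<close>
definition macmahon_U :: "nat \<Rightarrow> rat fps" where
  "macmahon_U a = (\<Sum>\<^sub>\<infinity>K\<in>macmahon_index a. macmahon_term K)"

definition sigma :: "nat \<Rightarrow> nat \<Rightarrow> nat" where
  "sigma \<nu> n = (\<Sum>d | d dvd n. d ^ \<nu>)"

text \<open>The series \<open>\<Sum>n\<ge>1. sigma \<nu> n * q ^ n\<close>.\<close>
definition sigma_fps :: "nat \<Rightarrow> rat fps" where
  "sigma_fps \<nu> = Abs_fps (\<lambda>n. if n = 0 then 0 else of_nat (sigma \<nu> n))"

definition E2 :: "rat fps" where "E2 = 1 - 24 * sigma_fps 1"
definition E4 :: "rat fps" where "E4 = 1 + 240 * sigma_fps 3"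
definition E6 :: "rat fps" where "E6 = 1 - 504 * sigma_fps 5"

text \<open>
  The arguments are integers so that the recursion may step to negative ones.  Each recursive
  call lowers the weight \<open>\<alpha> + 2 * \<beta> + 3 * \<gamma>\<close> by one.
\<close>
function coeff_c :: "int \<Rightarrow> int \<Rightarrow> int \<Rightarrow> rat" where
  "coeff_c \<alpha> \<beta> \<gamma> =
     (if \<alpha> = 0 \<and> \<beta> = 0 \<and> \<gamma> = 0 then 1
      else if \<alpha> < 0 \<or> \<beta> < 0 \<or> \<gamma> < 0 then 0
      else - (1 / 3) * of_int (2 * \<alpha> + 8 * \<beta> + 12 * \<gamma> + 1) * coeff_c (\<alpha> - 1) \<beta> \<gamma>
           + (2 / 3) * of_int (\<alpha> + 1) * coeff_c (\<alpha> + 1) (\<beta> - 1) \<gamma>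
           + (8 / 3) * of_int (\<beta> + 1) * coeff_c \<alpha> (\<beta> + 1) (\<gamma> - 1)
           + 4 * of_int (\<gamma> + 1) * coeff_c \<alpha> (\<beta> - 2) (\<gamma> + 1))"
  by auto
termination
  by (relation "measure (\<lambda>(\<alpha>, \<beta>, \<gamma>). nat (\<alpha> + 2 * \<beta> + 3 * \<gamma>))") auto

text \<open>The defining equation would make the simplifier loop.\<close>
declare coeff_c.simps [simp del]

text \<open>The tuples \<open>0 \<le> l\<^sub>1 < \<dots> < l\<^sub>t < a\<close> are again represented by their sets of entries.\<close>
definition weight_w :: "nat \<Rightarrow> nat \<Rightarrow> rat" where
  "weight_w t a = of_nat ((2 * a) choose a) / (16 ^ a * (2 * of_nat a + 1)) *
     (\<Sum>L | L \<subseteq> {..<a} \<and> card L = t. \<Prod>l\<in>L. 1 / (2 * of_nat l + 1)\<^sup>2)"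


lemma macmahon_summable: "macmahon_term summable_on macmahon_index a"
proof -
  define S where "S = (\<lambda>n. {K \<in> macmahon_index a. K \<subseteq> {..n}})"
  have fin: "finite (S n)" for n
    by (rule finite_subset[of _ "Pow {..n}"]) (auto simp: S_def)
  have vanish: "fps_nth (macmahon_term K) n = 0" if K: "K \<in> macmahon_index a" "K \<notin> S n" for K n
  proof -
    from K obtain k where k: "k \<in> K" "n < k" and "finite K" and pos: "\<forall>k\<in>K. 0 < k"
      unfolding S_def macmahon_index_def by force
    have "k \<le> (\<Sum>k\<in>K. k)"
      using k \<open>finite K\<close> by (intro member_le_sum) auto
    hence lt: "n < (\<Sum>k\<in>K. k)" using k by linarith
    have "fps_nth (\<Prod>k\<in>K. (1 - fps_X ^ k)\<^sup>2 :: rat fps) 0 = 1"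
      using \<open>finite K\<close> pos
      by (induction K rule: finite_induct) (auto simp: fps_power_zeroth zero_power)
    hence "macmahon_term K = fps_X ^ (\<Sum>k\<in>K. k) * inverse (\<Prod>k\<in>K. (1 - fps_X ^ k)\<^sup>2)"
      unfolding macmahon_term_def by (subst fps_divide_unit) auto
    thus ?thesis using lt by (simp add: fps_X_power_mult_nth)
  qed
  define F where "F = Abs_fps (\<lambda>n. \<Sum>K\<in>S n. fps_nth (macmahon_term K) n)"
  have "(macmahon_term has_sum F) (macmahon_index a)"
    unfolding has_sum_def
  proof (rule tendsto_fpsI)
    fix n
    show "\<forall>\<^sub>F A in finite_subsets_at_top (macmahon_index a).
            fps_nth (sum macmahon_term A) n = fps_nth F n"
      unfolding eventually_finite_subsets_at_top
    proof (intro exI[of _ "S n"] conjI allI impI fin)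
      show "S n \<subseteq> macmahon_index a" by (auto simp: S_def)
      fix A assume A: "finite A \<and> S n \<subseteq> A \<and> A \<subseteq> macmahon_index a"
      have "(\<Sum>K\<in>A. fps_nth (macmahon_term K) n) = (\<Sum>K\<in>S n. fps_nth (macmahon_term K) n)"
        using A vanish by (intro sum.mono_neutral_right) auto
      thus "fps_nth (sum macmahon_term A) n = fps_nth F n"
        by (simp add: F_def fps_sum_nth)
    qed
  qed
  thus ?thesis unfolding summable_on_def by blast
qed

lemma macmahon_U_0: "macmahon_U 0 = 1"
proof -
  have "macmahon_index 0 = {{}}" by (auto simp: macmahon_index_def)
  thus ?thesis by (simp add: macmahon_U_def macmahon_term_def)
qed

lemma finite_weight: "finite {(\<alpha>, \<beta>, \<gamma>). \<alpha> + 2 * \<beta> + 3 * \<gamma> = (t :: nat)}"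
  by (rule finite_subset[of _ "{..t} \<times> {..t} \<times> {..t}"]) auto

end

(*
  Write x = 2 - z - 1/z, so that (1 - z q^k)(1 - q^k/z) = (1 - q^k)^2 + x q^k.  The Jacobi triple
  product then turns the generating function of the U_a in powers of x into
    U_a * eta3 = sum_m (-1)^m q^(m(m+1)/2) cheb(m, a),   eta3 = sum_m (-1)^m (2m+1) q^(m(m+1)/2),
  where cheb(m, a) is 2m+1 times the polynomial sum_t w_t(a) y^t, a product of linear factors, at
  y = -(2m+1)^2.  On the other hand q^(m(m+1)/2 + 1/8) is an eigenvector of -8 q d/dq with
  eigenvalue -(2m+1)^2, so the factor y^t amounts to applying this operator t times to
  q^(1/8) eta3 = eta^3.  By Ramanujan's differential equations for E2, E4, E6 and
  q d/dq eta^3 = (E2 / 8) eta^3, the operator acts on (polynomial in E2, E4, E6) * eta^3 by exactly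
  the recursion that defines c(alpha, beta, gamma).

  Ramanujan's equations are convolution identities for divisor sums.  They come from a symmetry of
  the solutions of a x + b y = n: if p(u, v) is an even symmetric function of u, v, -u-v, then
  p(a, b) and p(a, b - a) have the same sum over all solutions up to the terms with x = y or a = b.
*)
theory Submission
  imports Defs
begin

section \<open>A finite Jacobi triple product\<close>

text \<open>
  The coefficient of \<open>x ^ a\<close> in the Laurent polynomial \<open>z ^ (- m) + \<dots> + z ^ m\<close>, written as a
  polynomial in \<open>x = 2 - z - 1 / z\<close>.
\<close>
definition cheb :: "nat \<Rightarrow> nat \<Rightarrow> rat" where
  "cheb m a = (- 1) ^ a * of_nat ((m + a + 1 choose (2 * a + 1)) + (m + a choose (2 * a + 1)))"

lemma cheb_0_right [simp]: "cheb m 0 = 2 * of_nat m + 1"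
  by (simp add: cheb_def)

lemma cheb_0_Suc [simp]: "cheb 0 (Suc a) = 0"
  by (simp add: cheb_def binomial_eq_0)

lemma cheb_1_Suc: "cheb (Suc 0) (Suc a) = - cheb 0 a"
  by (cases a) (simp_all add: cheb_def binomial_eq_0 numeral_3_eq_3)

text \<open>Let S_m = z^(-m) + ... + z^m. Then S_(m+2) + S_m = (z + 1/z) S_(m+1), and z + 1/z = 2 -
  x.\<close>

lemma cheb_rec:
  "cheb (Suc (Suc m)) (Suc a) + cheb m (Suc a) = 2 * cheb (Suc m) (Suc a) - cheb (Suc m) a"
  by (simp add: cheb_def algebra_simps)

lemma binomial_step:
  "of_nat (Suc k) * of_nat (n choose Suc k) = (of_nat n - of_nat k) * (of_nat (n choose k) :: rat)"
proof -
  have "of_nat (Suc k) * of_nat (Suc n choose Suc k) = (of_nat (Suc n) * of_nat (n choose k) :: rat)"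
    unfolding of_nat_mult[symmetric] Suc_times_binomial ..
  thus ?thesis by (simp add: algebra_simps)
qed

text \<open>Absorption reduces both binomials to multiples of (m+a choose 2a), with factors m+a+1
  and m-a whose sum is 2m+1.\<close>

lemma cheb_closed_form:
  "(2 * of_nat a + 1) * cheb m a = (- 1) ^ a * (2 * of_nat m + 1) * of_nat (m + a choose (2 * a))"
proof -
  have "of_nat (Suc (2 * a)) * of_nat (Suc (m + a) choose Suc (2 * a))
      = (of_nat (Suc (m + a)) * of_nat (m + a choose (2 * a)) :: rat)"
    unfolding of_nat_mult[symmetric] Suc_times_binomial ..
  hence 1: "(2 * of_nat a + 1) * of_nat (Suc (m + a) choose Suc (2 * a)) =
     (of_nat m + of_nat a + 1) * (of_nat (m + a choose (2 * a)) :: rat)"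
    by (simp add: add_ac del: binomial_Suc_Suc)
  have 2: "(2 * of_nat a + 1) * of_nat (m + a choose Suc (2 * a)) =
     (of_nat m - of_nat a) * (of_nat (m + a choose (2 * a)) :: rat)"
    using binomial_step[of "2 * a" "m + a"] by (simp add: add_ac)
  have "(2 * of_nat a + 1) * cheb m a =
    (- 1) ^ a * ((2 * of_nat a + 1) * of_nat (Suc (m + a) choose Suc (2 * a))
      + (2 * of_nat a + 1) * of_nat (m + a choose Suc (2 * a)))"
    unfolding cheb_def by (simp add: distrib_left mult_ac del: binomial_Suc_Suc)
  also have "\<dots> = (- 1) ^ a * (2 * of_nat m + 1) * of_nat (m + a choose (2 * a))"
    unfolding 1 2 by (simp add: algebra_simps)
  finally show ?thesis .
qed

text \<open>The factor (a-m)(a+m+1) is a quarter of (2a+1)^2 - (2m+1)^2; this is the source of the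
  linear factors in \<open>cheb_prod\<close>.\<close>

lemma cheb_ratio:
  "(2 * of_nat a + 2) * (2 * of_nat a + 3) * cheb m (Suc a) =
     (of_nat a - of_nat m) * (of_nat a + of_nat m + 1) * cheb m a"
proof -
  define C where "C = (of_nat (m + a choose (2 * a)) :: rat)"
  define r s where "r = (of_nat a :: rat)" and "s = (of_nat m :: rat)"
  have "of_nat (Suc (Suc (2 * a))) * of_nat (Suc (m + a) choose Suc (Suc (2 * a)))
      = (of_nat (Suc (m + a)) * of_nat (m + a choose Suc (2 * a)) :: rat)"
    unfolding of_nat_mult[symmetric] Suc_times_binomial ..
  hence "(2 * r + 2) * of_nat (Suc (m + a) choose Suc (Suc (2 * a))) =
     (s + r + 1) * of_nat (m + a choose Suc (2 * a))"
    by (simp add: r_def s_def add_ac del: binomial_Suc_Suc)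
  moreover have "(2 * r + 1) * of_nat (m + a choose Suc (2 * a)) = (s - r) * C"
    using binomial_step[of "2 * a" "m + a"] by (simp add: r_def s_def C_def add_ac)
  ultimately have C: "(2 * r + 1) * ((2 * r + 2) * of_nat (Suc (m + a) choose Suc (Suc (2 * a))))
      = (s + r + 1) * ((s - r) * C)"
    by (metis mult.left_commute)
  \<comment> \<open>The extra factor 2a+1 makes \<open>cheb_closed_form\<close> applicable at a; it
    is cancelled at the end.\<close>
  have "(2 * r + 1) * ((2 * r + 2) * (2 * r + 3) * cheb m (Suc a)) =
      (2 * r + 1) * (2 * r + 2) * ((2 * of_nat (Suc a) + 1) * cheb m (Suc a))"
    by (simp add: r_def algebra_simps)
  also have "\<dots> = - ((- 1) ^ a * (2 * s + 1) *
      ((2 * r + 1) * ((2 * r + 2) * of_nat (Suc (m + a) choose Suc (Suc (2 * a))))))"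
    unfolding cheb_closed_form by (simp add: s_def mult_ac del: binomial_Suc_Suc)
  also have "\<dots> = (r - s) * (s + r + 1) * ((- 1) ^ a * (2 * s + 1) * C)"
    unfolding C by (simp add: algebra_simps)
  also have "\<dots> = (2 * r + 1) * ((r - s) * (r + s + 1) * cheb m a)"
    unfolding C_def s_def cheb_closed_form[symmetric] by (simp add: r_def mult_ac add_ac)
  finally have "(2 * r + 1) * ((2 * r + 2) * (2 * r + 3) * cheb m (Suc a)) =
     (2 * r + 1) * ((r - s) * (r + s + 1) * cheb m a)" .
  moreover have "2 * r + 1 \<noteq> 0" unfolding r_def by (metis add.commute of_nat_Suc of_nat_eq_0_iff of_nat_mult of_nat_numeral Zero_not_Suc)
  ultimately show ?thesis unfolding r_def s_def by (metis mult_left_cancel)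
qed

section \<open>q-factorials and Gaussian binomial coefficients\<close>

definition qpoch :: "nat \<Rightarrow> rat fps" where
  "qpoch n = (\<Prod>k=1..n. 1 - fps_X ^ k)"

lemma qpoch_0 [simp]: "qpoch 0 = 1"
  and qpoch_Suc: "qpoch (Suc n) = qpoch n * (1 - fps_X ^ Suc n)"
  by (simp_all add: qpoch_def)

lemma qpoch_nth_0 [simp]: "fps_nth (qpoch n) 0 = 1"
  by (induction n) (simp_all add: qpoch_Suc)

text \<open>The value \<open>0\<close> at negative arguments makes \<open>qrec_step\<close> hold at \<open>i = 0\<close> as well.\<close>
definition qrec :: "int \<Rightarrow> rat fps" where
  "qrec i = (if i < 0 then 0 else inverse (qpoch (nat i)))"

lemma qrec_step:
  assumes "i \<ge> 0"
  shows "qrec (i - 1) = qrec i * (1 - fps_X ^ nat i)"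
proof (cases "i = 0")
  case False
  define n where "n = nat (i - 1)"
  have i: "i = int (Suc n)" using assms False by (simp add: n_def)
  have "inverse (qpoch (Suc n)) * (1 - fps_X ^ Suc n) = inverse (qpoch n)"
    by (simp add: qpoch_Suc fps_inverse_mult mult.assoc inverse_mult_eq_1 del: power_Suc)
  moreover have "nat (int (Suc n) - 1) = n" by simp
  ultimately show ?thesis by (simp add: i qrec_def del: power_Suc of_nat_Suc)
qed (simp add: qrec_def)

text \<open>The Gaussian binomial coefficient \<open>2 * N + 1\<close> over \<open>N - m\<close>.\<close>
definition gauss :: "nat \<Rightarrow> int \<Rightarrow> rat fps" where
  "gauss N m = qpoch (2 * N + 1) * qrec (int N - m) * qrec (int N + 1 + m)"

lemma gauss_minus_1: "gauss N (- 1) = gauss N 0"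
  by (simp add: gauss_def mult_ac)

lemma gauss_gt: "m > int N \<Longrightarrow> gauss N m = 0"
  by (simp add: gauss_def qrec_def)

text \<open>This amounts to two q-Pascal steps, from row 2N+1 to row 2N+3. Every Gaussian binomial
  involved is a multiple of P a b, and what remains is (1 - Q^2)(1 - AB) = (1 + Q^2)(1 - A)(1 - B) +
  (1 - B)(A - Q^2) + (1 - A)(B - Q^2).\<close>

lemma gauss_rec:
  assumes "0 \<le> m" "m \<le> int N + 1"
  shows "gauss (Suc N) m = (1 + (fps_X ^ Suc N)\<^sup>2) * gauss N m
           + fps_X ^ nat (int N + 1 - m) * gauss N (m - 1)
           + fps_X ^ nat (int N + 2 + m) * gauss N (m + 1)"
proof -
  define P a b A B Q
    where "P = qpoch (2 * N + 1)" and "a = qrec (int N + 1 - m)" and "b = qrec (int N + 2 + m)"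
      and "A = (fps_X :: rat fps) ^ nat (int N + 1 - m)"
      and "B = (fps_X :: rat fps) ^ nat (int N + 2 + m)" and "Q = (fps_X :: rat fps) ^ Suc N"
  define B' where "B' = (fps_X :: rat fps) ^ nat (int N + 1 + m)"
  have AB': "A * B' = Q\<^sup>2"
    unfolding A_def B'_def Q_def power_add[symmetric] power_mult[symmetric]
    by (rule arg_cong[where f = "\<lambda>n. fps_X ^ n"]) (use assms in auto)
  have AB: "A * B = fps_X ^ (2 * N + 3)"
    unfolding A_def B_def Q_def power_add[symmetric] power_mult[symmetric]
    by (rule arg_cong[where f = "\<lambda>n. fps_X ^ n"]) (use assms in linarith)
  have P: "qpoch (2 * Suc N + 1) = P * (1 - Q\<^sup>2) * (1 - A * B)"
    unfolding AB Q_def P_def power_mult[symmetric]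
    by (simp add: qpoch_Suc numeral_3_eq_3 mult_ac)
  have a1: "qrec (int N - m) = a * (1 - A)"
    using qrec_step[of "int N + 1 - m"] assms by (simp add: a_def A_def algebra_simps)
  have b1: "qrec (int N + 1 + m) = b * (1 - B)"
    using qrec_step[of "int N + 2 + m"] assms by (simp add: b_def B_def algebra_simps)
  have b2: "qrec (int N + m) = b * (1 - B) * (1 - B')"
    using qrec_step[of "int N + 1 + m"] assms unfolding b1[symmetric] by (simp add: B'_def add_ac)
  \<comment> \<open>At m = N+1 the left side is 0 by the default value of \<open>qrec\<close>, the
    right side because A = 1. For smaller m, \<open>qrec_step\<close> applies once more.\<close>
  have ab2: "B * qrec (int N - m - 1) = a * (1 - A) * (B - Q\<^sup>2)"
  proof (cases "m = int N + 1")
    case True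
    thus ?thesis by (simp add: qrec_def A_def)
  next
    case False
    define A' where "A' = (fps_X :: rat fps) ^ nat (int N - m)"
    have "A' * B = Q\<^sup>2"
      unfolding A'_def B_def Q_def power_add[symmetric] power_mult[symmetric]
      by (rule arg_cong[where f = "\<lambda>n. fps_X ^ n"]) (use assms False in auto)
    moreover have "qrec (int N - m - 1) = qrec (int N - m) * (1 - A')"
      using qrec_step[of "int N - m"] assms False by (simp add: A'_def)
    hence "B * qrec (int N - m - 1) = a * (1 - A) * (B - A' * B)"
      unfolding a1 by (simp add: right_diff_distrib left_diff_distrib mult_ac)
    ultimately show ?thesis by simp
  qed
  have "gauss (Suc N) m = P * (1 - Q\<^sup>2) * (1 - A * B) * a * b"
    unfolding gauss_def P by (simp add: a_def b_def algebra_simps)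
  also have "\<dots> = (1 + Q\<^sup>2) * (P * (a * (1 - A)) * (b * (1 - B))) + P * a * b * (1 - B) * (A - A * B')
                 + P * (a * (1 - A) * (B - Q\<^sup>2)) * b"
    unfolding AB' by (simp add: algebra_simps)
  also have "\<dots> = (1 + Q\<^sup>2) * (P * qrec (int N - m) * qrec (int N + 1 + m))
               + A * (P * a * qrec (int N + m)) + B * (P * qrec (int N - m - 1) * b)"
    unfolding ab2[symmetric] a1 b1 b2 by (simp add: algebra_simps)
  finally show ?thesis
    by (simp add: gauss_def P_def A_def B_def Q_def a_def b_def algebra_simps)
qed

definition tri :: "nat \<Rightarrow> nat" where "tri m = m * (m + 1) div 2"

lemma tri_0 [simp]: "tri 0 = 0"
  by (simp add: tri_def)

lemma tri_Suc: "tri (Suc m) = tri m + Suc m"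
  by (simp add: tri_def)

lemma two_tri: "2 * tri m = m * (m + 1)"
  by (simp add: tri_def)

lemma le_tri: "m \<le> tri m"
  by (induction m) (simp_all add: tri_Suc)

text \<open>
  The coefficient of \<open>z ^ (- m) + \<dots> + z ^ m\<close> in the product of
  \<open>(1 - z * q ^ k) * (1 - q ^ k / z) = (1 - q ^ k) ^ 2 + x * q ^ k\<close> over \<open>1 \<le> k \<le> N\<close>.
\<close>
definition jtp :: "nat \<Rightarrow> nat \<Rightarrow> rat fps" where
  "jtp N m = (- 1) ^ m * fps_X ^ tri m * gauss N (int m)"

lemma jtp_gt: "m > N \<Longrightarrow> jtp N m = 0"
  by (simp add: jtp_def gauss_gt)

text \<open>The new factor of the product is 1 + Q^2 - Q (z + 1/z) with Q = q^(N+1). Multiplication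
  by z + 1/z sends S_m = z^(-m) + ... + z^m to S_(m+1) + S_(m-1), where S_(-1) = 0 - S_0 * 1 must be
  read as -S_0 because z + 1/z = S_1 - S_0.\<close>

lemma jtp_rec_0:
  "jtp (Suc N) 0 = (1 + (fps_X ^ Suc N)\<^sup>2) * jtp N 0 - fps_X ^ Suc N * (jtp N 1 - jtp N 0)"
proof -
  have n: "nat (1 + int N) = Suc N" "nat (int N + 1) = Suc N" "nat (int N + 2) = Suc (Suc N)" by auto
  show ?thesis
    using gauss_rec[of 0 N]
    by (simp add: n) (simp add: jtp_def gauss_minus_1 tri_def algebra_simps)
qed

lemma jtp_rec_Suc:
  "jtp (Suc N) (Suc m) = (1 + (fps_X ^ Suc N)\<^sup>2) * jtp N (Suc m)
     - fps_X ^ Suc N * (jtp N (Suc (Suc m)) + jtp N m)"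
proof (cases "m \<le> N")
  case True
  define g0 g1 g2 where "g0 = gauss N (int m)" and "g1 = gauss N (int m + 1)"
    and "g2 = gauss N (int m + 2)"
  have n: "nat (int N + 1 - int (Suc m)) = N - m" "nat (int N + 2 + int (Suc m)) = N + m + 3"
    using True by auto
  have G: "gauss (Suc N) (1 + int m) = (1 + (fps_X ^ Suc N)\<^sup>2) * g1 + fps_X ^ (N - m) * g0 + fps_X ^ (N + m + 3) * g2"
    using gauss_rec[of "int (Suc m)" N] True unfolding n
    by (simp add: g0_def g1_def g2_def add_ac)
  have j: "jtp N m = (- 1) ^ m * fps_X ^ tri m * g0"
     "jtp N (Suc m) = (- 1) ^ Suc m * fps_X ^ (tri m + Suc m) * g1"
     "jtp N (Suc (Suc m)) = (- 1) ^ m * fps_X ^ (tri m + Suc m + Suc (Suc m)) * g2"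
    by (simp_all add: jtp_def tri_Suc g0_def g1_def g2_def add_ac)
  \<comment> \<open>The exponents in \<open>gauss_rec\<close> fit the gaps between consecutive
    triangular numbers, so that each neighbour contributes exactly one factor q^(N+1).\<close>
  have e1: "fps_X ^ (tri m + Suc m) * fps_X ^ (N - m) = (fps_X ^ Suc N * fps_X ^ tri m :: rat fps)"
    unfolding power_add[symmetric]
    by (rule arg_cong[where f = "\<lambda>n. fps_X ^ n"]) (use True in linarith)
  have e2: "fps_X ^ (tri m + Suc m) * fps_X ^ (N + m + 3)
      = (fps_X ^ Suc N * fps_X ^ (tri m + Suc m + Suc (Suc m)) :: rat fps)"
    unfolding power_add[symmetric]
    by (rule arg_cong[where f = "\<lambda>n. fps_X ^ n"]) simp
  have "jtp (Suc N) (Suc m) = (- 1) ^ Suc m * ((1 + (fps_X ^ Suc N)\<^sup>2) * (fps_X ^ (tri m + Suc m) * g1)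
      + (fps_X ^ (tri m + Suc m) * fps_X ^ (N - m)) * g0
      + (fps_X ^ (tri m + Suc m) * fps_X ^ (N + m + 3)) * g2)"
    unfolding jtp_def tri_Suc by (simp add: G distrib_left mult_ac del: power_Suc)
  also have "\<dots> = (1 + (fps_X ^ Suc N)\<^sup>2) * jtp N (Suc m)
     - fps_X ^ Suc N * (jtp N (Suc (Suc m)) + jtp N m)"
    unfolding e1 e2 unfolding j power_Suc[of "-1"]
    by (simp add: distrib_left mult_ac del: power_Suc)
  finally show ?thesis .
qed (simp add: jtp_gt)

text \<open>The coefficient of \<open>x ^ a\<close> in the same product.\<close>
fun esym :: "nat \<Rightarrow> nat \<Rightarrow> rat fps" where
  "esym 0 a = (if a = 0 then 1 else 0)"
| "esym (Suc N) 0 = (1 - fps_X ^ Suc N)\<^sup>2 * esym N 0"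
| "esym (Suc N) (Suc a) = (1 - fps_X ^ Suc N)\<^sup>2 * esym N (Suc a) + fps_X ^ Suc N * esym N a"

lemma esym_rec:
  "esym (Suc N) a = (1 - fps_X ^ Suc N)\<^sup>2 * esym N a +
     (if a = 0 then 0 else fps_X ^ Suc N * esym N (a - 1))"
  by (cases a) simp_all

text \<open>Multiplication by z + 1/z = 2 - x, read off at x^a. The case m = 0 encodes S_(-1) =
  -S_0.\<close>

lemma cheb_shift_sum:
  "(\<Sum>m\<le>N. jtp N m * fps_const ((if m = 0 then - cheb 0 a else cheb (m - 1) a) + cheb (Suc m) a))
   = 2 * (\<Sum>m\<le>N. jtp N m * fps_const (cheb m a)) -
     (if a = 0 then 0 else (\<Sum>m\<le>N. jtp N m * fps_const (cheb m (a - 1))))"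
proof -
  have c: "(if m = 0 then - cheb 0 a else cheb (m - 1) a) + cheb (Suc m) a
      = 2 * cheb m a - (if a = 0 then 0 else cheb m (a - 1))" for m
  proof (cases m)
    case 0
    thus ?thesis by (cases a) (simp_all add: cheb_1_Suc)
  next
    case (Suc l)
    thus ?thesis using cheb_rec[of l "a - 1"] by (cases a) simp_all
  qed
  show ?thesis unfolding c
    by (cases "a = 0") (simp_all add: sum_subtractf sum_distrib_left algebra_simps numeral_fps_const
        del: cheb_0_right flip: fps_const_sub fps_const_mult)
qed

text \<open>Induction on N: in the recursion for \<open>jtp\<close> the index shifts are moved onto
  \<open>cheb\<close>, so the right side is multiplied by 1 + Q^2 - Q (2 - x) = (1 - Q)^2 + Q x,
  which is the recursion of \<open>esym\<close>.\<close>

lemma finite_jtp: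
  "esym N a = (\<Sum>m\<le>N. jtp N m * fps_const (cheb m a))"
proof (induction N arbitrary: a)
  case 0
  have "qpoch (Suc 0) * inverse (qpoch (Suc 0)) = 1" by (simp add: inverse_mult_eq_1')
  thus ?case by (cases a) (simp_all add: jtp_def gauss_def qrec_def )
next
  case (Suc N)
  define Q where "Q = (fps_X :: rat fps) ^ Suc N"
  define S where "S = (\<lambda>a. \<Sum>m\<le>N. jtp N m * fps_const (cheb m a))"
  have "(\<Sum>m\<le>Suc N. jtp (Suc N) m * fps_const (cheb m a)) =
      jtp (Suc N) 0 * fps_const (cheb 0 a) + (\<Sum>m\<le>N. jtp (Suc N) (Suc m) * fps_const (cheb (Suc m) a))"
    by (rule sum.atMost_Suc_shift)
  also have "\<dots> = (1 + Q\<^sup>2) * (jtp N 0 * fps_const (cheb 0 a) + (\<Sum>m\<le>N. jtp N (Suc m) * fps_const (cheb (Suc m) a)))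
    - Q * (- (jtp N 0 * fps_const (cheb 0 a)) + (jtp N 1 * fps_const (cheb 0 a)
             + (\<Sum>m\<le>N. jtp N (Suc (Suc m)) * fps_const (cheb (Suc m) a)))
       + (\<Sum>m\<le>N. jtp N m * fps_const (cheb (Suc m) a)))"
    unfolding jtp_rec_0 jtp_rec_Suc Q_def[symmetric]
    by (simp add: algebra_simps sum.distrib sum_subtractf sum_distrib_left)
  also have "jtp N 0 * fps_const (cheb 0 a) + (\<Sum>m\<le>N. jtp N (Suc m) * fps_const (cheb (Suc m) a)) = S a"
    unfolding sum.atMost_Suc_shift[symmetric, of "\<lambda>m. jtp N m * fps_const (cheb m a)"] S_def
    by (simp add: jtp_gt)
  also have "(jtp N 1 * fps_const (cheb 0 a)
             + (\<Sum>m\<le>N. jtp N (Suc (Suc m)) * fps_const (cheb (Suc m) a)))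
       = (\<Sum>m\<le>N. jtp N (Suc m) * fps_const (cheb m a))"
    using sum.atMost_Suc_shift[symmetric, of "\<lambda>m. jtp N (Suc m) * fps_const (cheb m a)" N]
    by (simp add: jtp_gt)
  also have "- (jtp N 0 * fps_const (cheb 0 a)) + (\<Sum>m\<le>N. jtp N (Suc m) * fps_const (cheb m a))
    = (\<Sum>m\<le>Suc N. jtp N m * fps_const (if m = 0 then - cheb 0 a else cheb (m - 1) a))"
    unfolding sum.atMost_Suc_shift by (simp flip: fps_const_neg)
  also have "\<dots> = (\<Sum>m\<le>N. jtp N m * fps_const (if m = 0 then - cheb 0 a else cheb (m - 1) a))"
    by (simp add: jtp_gt)
  also have "\<dots> + (\<Sum>m\<le>N. jtp N m * fps_const (cheb (Suc m) a))
     = 2 * S a - (if a = 0 then 0 else S (a - 1))"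
    unfolding cheb_shift_sum[symmetric] S_def
    by (simp add: sum.distrib distrib_left flip: fps_const_add)
  finally have *: "(\<Sum>m\<le>Suc N. jtp (Suc N) m * fps_const (cheb m a)) =
    (1 + Q\<^sup>2) * S a - Q * (2 * S a - (if a = 0 then 0 else S (a - 1)))" .
  have IH: "esym N a = S a" for a
    by (simp add: Suc S_def)
  show ?case
    unfolding esym_rec IH Q_def[symmetric] *
    by (simp add: algebra_simps power2_eq_square)
qed

section \<open>MacMahon's series as quotients of theta series\<close>

definition fps_cong :: "nat \<Rightarrow> rat fps \<Rightarrow> rat fps \<Rightarrow> bool" where
  "fps_cong n f g \<longleftrightarrow> fps_X ^ n dvd f - g"

lemma fps_cong_nth: "fps_cong n f g \<longleftrightarrow> (\<forall>i<n. fps_nth f i = fps_nth g i)"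
proof
  assume "fps_cong n f g"
  then obtain h where "f - g = fps_X ^ n * h" unfolding fps_cong_def by (elim dvdE)
  hence "fps_nth (f - g) i = 0" if "i < n" for i
    using that by (simp add: fps_X_power_mult_nth)
  thus "\<forall>i<n. fps_nth f i = fps_nth g i" by simp
next
  assume "\<forall>i<n. fps_nth f i = fps_nth g i"
  hence "fps_cutoff n (f - g) = 0" by (simp add: fps_eq_iff)
  hence "f - g = fps_X ^ n * fps_shift n (f - g)"
    using fps_shift_cutoff'[of n "f - g"] by simp
  thus "fps_cong n f g" unfolding fps_cong_def by (metis dvd_triv_left)
qed

lemma fps_cong_refl [simp]: "fps_cong n f f"
  by (simp add: fps_cong_def)

lemma fps_cong_sym: "fps_cong n f g \<Longrightarrow> fps_cong n g f"
  by (simp add: fps_cong_nth)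

lemma fps_cong_trans [trans]: "fps_cong n f g \<Longrightarrow> fps_cong n g h \<Longrightarrow> fps_cong n f h"
  by (simp add: fps_cong_nth)

lemma fps_cong_sum: "(\<And>x. x \<in> A \<Longrightarrow> fps_cong n (f x) (g x)) \<Longrightarrow> fps_cong n (sum f A) (sum g A)"
  by (simp add: fps_cong_nth fps_sum_nth)

lemma fps_cong_mult:
  assumes "fps_cong n f g" "fps_cong n f' g'"
  shows "fps_cong n (f * f') (g * g')"
proof -
  have "f * f' - g * g' = (f - g) * f' + g * (f' - g')" by (simp add: algebra_simps)
  thus ?thesis using assms by (simp add: fps_cong_def)
qed

lemma fps_cong_X_power_mult:
  assumes "fps_cong n f g" "k \<le> n + l"
  shows "fps_cong k (fps_X ^ l * f) (fps_X ^ l * g)"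
proof -
  have "fps_X ^ (l + n) dvd fps_X ^ l * (f - g)"
    using assms(1) unfolding fps_cong_def power_add by (intro mult_dvd_mono) simp_all
  moreover have "(fps_X :: rat fps) ^ k dvd fps_X ^ (l + n)"
    using assms(2) by (intro le_imp_power_dvd) simp
  ultimately show ?thesis
    unfolding fps_cong_def right_diff_distrib[symmetric] by (rule dvd_trans[rotated])
qed

lemma fps_eqI_cong: "(\<And>N. fps_cong (Suc N) f g) \<Longrightarrow> f = g"
  by (auto simp: fps_eq_iff fps_cong_nth)

lemma qpoch_cong:
  assumes "i \<le> j"
  shows "fps_cong (Suc i) (qpoch j) (qpoch i)"
  using assms
proof (induction j rule: dec_induct)
  case (step j)
  have "fps_cong (Suc i) (1 - fps_X ^ Suc j) 1"
    using step(1) unfolding fps_cong_def by (simp add: le_imp_power_dvd del: power_Suc)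
  from fps_cong_mult[OF step(3) this] show ?case
    by (simp add: qpoch_Suc)
qed simp

lemma qpoch_inverse_cong:
  assumes "i \<le> j" "k \<le> Suc i"
  shows "fps_cong k (qpoch j * inverse (qpoch i)) 1"
proof -
  have "qpoch i * inverse (qpoch i) = 1" by (simp add: inverse_mult_eq_1')
  hence "fps_cong (Suc i) (qpoch j * inverse (qpoch i)) 1"
    using fps_cong_mult[OF qpoch_cong[OF assms(1)] fps_cong_refl, of "inverse (qpoch i)"] by simp
  thus ?thesis using assms(2) by (simp add: fps_cong_nth)
qed

text \<open>The limit of the finite triple product. The quotients of q-factorials are 1 only modulo
  q^(N+1-m), but the prefactor q^(tri m) makes up for the loss since m \<le> tri m.\<close>

lemma jtp_cong:
  assumes "m \<le> N"
  shows "fps_cong (Suc N) (qpoch N * jtp N m) (fps_const ((- 1) ^ m) * fps_X ^ tri m)"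
proof -
  have n: "nat (int N - int m) = N - m" "nat (int N + 1 + int m) = N + 1 + m" using assms by auto
  have "fps_cong (Suc N - m) ((qpoch N * inverse (qpoch (N - m))) *
          (qpoch (2 * N + 1) * inverse (qpoch (N + 1 + m)))) (1 * 1)"
    by (rule fps_cong_mult; rule qpoch_inverse_cong) (use assms in auto)
  also have "(qpoch N * inverse (qpoch (N - m))) *
          (qpoch (2 * N + 1) * inverse (qpoch (N + 1 + m))) = qpoch N * gauss N (int m)"
    using assms unfolding gauss_def qrec_def n by (simp add: mult_ac)
  finally have "fps_cong (Suc N) (fps_X ^ tri m * (qpoch N * gauss N (int m))) (fps_X ^ tri m * 1)"
    using le_tri[of m] by (intro fps_cong_X_power_mult) auto
  from fps_cong_mult[OF fps_cong_refl this, of "fps_const ((- 1) ^ m)"] show ?thesis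
    by (simp add: jtp_def mult_ac flip: fps_const_power fps_const_neg)
qed

text \<open>The theta-like series with terms g(m) q^(tri m). As \<open>tri\<close> is injective,
  each coefficient has at most one summand.\<close>

definition tri_series :: "(nat \<Rightarrow> rat) \<Rightarrow> rat fps" where
  "tri_series g = Abs_fps (\<lambda>n. \<Sum>m | tri m = n. g m)"

lemma tri_series_cong:
  "fps_cong (Suc N) (tri_series g) (\<Sum>m\<le>N. fps_const (g m) * fps_X ^ tri m)"
  unfolding fps_cong_nth
proof (intro allI impI)
  fix n assume n: "n < Suc N"
  have "{m. tri m = n} = {m \<in> {..N}. tri m = n}"
    using n le_tri by (fastforce dest: le_less_trans[OF le_tri])
  hence "fps_nth (tri_series g) n = (\<Sum>m\<le>N. if tri m = n then g m else 0)"
    unfolding tri_series_def fps_nth_Abs_fps by (simp only: sum.inter_filter[symmetric] finite_atMost)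
  thus "fps_nth (tri_series g) n = fps_nth (\<Sum>m\<le>N. fps_const (g m) * fps_X ^ tri m) n"
    by (simp add: fps_sum_nth fps_X_power_nth if_distrib[where f = "(*) _"] eq_commute[of n] cong: if_cong)
qed

lemma tri_series_const: "fps_const c * tri_series g = tri_series (\<lambda>m. c * g m)"
  by (simp add: tri_series_def fps_eq_iff sum_distrib_left)

lemma tri_series_sum: "(\<Sum>i\<in>I. tri_series (g i)) = tri_series (\<lambda>m. \<Sum>i\<in>I. g i m)"
  by (simp add: tri_series_def fps_eq_iff fps_sum_nth sum.swap[of _ I])

lemma tri_series_diff: "tri_series g - tri_series h = tri_series (\<lambda>m. g m - h m)"
  by (simp add: tri_series_def fps_eq_iff sum_subtractf)

lemma fps_XD_tri_series: "fps_XD (tri_series g) = tri_series (\<lambda>m. of_nat (tri m) * g m)"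
  by (simp add: tri_series_def fps_eq_iff sum_distrib_left)

section \<open>Truncations of MacMahon's series\<close>

definition macmahon_trunc :: "nat \<Rightarrow> nat \<Rightarrow> rat fps" where
  "macmahon_trunc N a = (\<Sum>K | K \<subseteq> {1..N} \<and> card K = a. macmahon_term K)"

lemma macmahon_term_eq:
  assumes "finite K" "\<forall>k\<in>K. 0 < k"
  shows "macmahon_term K = fps_X ^ (\<Sum>k\<in>K. k) * inverse (\<Prod>k\<in>K. (1 - fps_X ^ k)\<^sup>2)"
proof -
  have "fps_nth (\<Prod>k\<in>K. (1 - fps_X ^ k)\<^sup>2 :: rat fps) 0 = 1"
    using assms by (induction K rule: finite_induct) (auto simp: fps_power_zeroth zero_power)
  thus ?thesis unfolding macmahon_term_def by (subst fps_divide_unit) auto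
qed

lemma macmahon_term_insert:
  assumes "finite K" "\<forall>k\<in>insert n K. 0 < k" "n \<notin> K"
  shows "(1 - fps_X ^ n)\<^sup>2 * macmahon_term (insert n K) = fps_X ^ n * macmahon_term K"
proof -
  have "(1 - fps_X ^ n)\<^sup>2 * inverse ((1 - fps_X ^ n)\<^sup>2) = (1 :: rat fps)"
    using assms by (intro inverse_mult_eq_1') (simp add: fps_power_zeroth zero_power)
  hence "(1 - fps_X ^ n)\<^sup>2 * (fps_X ^ n * fps_X ^ \<Sum>K * (inverse ((1 - fps_X ^ n)\<^sup>2) * z))
    = fps_X ^ n * (fps_X ^ \<Sum>K * z)" for z :: "rat fps"
    by (metis (no_types, lifting) mult.assoc mult.left_commute mult.left_neutral)
  moreover have "macmahon_term (insert n K) = fps_X ^ n * fps_X ^ \<Sum>K *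
      (inverse ((1 - fps_X ^ n)\<^sup>2) * inverse (\<Prod>k\<in>K. (1 - fps_X ^ k)\<^sup>2))"
    using assms by (simp add: macmahon_term_eq fps_inverse_mult power_add)
  moreover have "macmahon_term K = fps_X ^ \<Sum>K * inverse (\<Prod>k\<in>K. (1 - fps_X ^ k)\<^sup>2)"
    using assms by (simp add: macmahon_term_eq)
  ultimately show ?thesis by (simp only:)
qed

lemma macmahon_trunc_0: "macmahon_trunc N 0 = 1"
proof -
  have "{K. K \<subseteq> {1..N} \<and> card K = 0} = {{}}" by (auto dest: finite_subset)
  thus ?thesis by (simp add: macmahon_trunc_def macmahon_term_def)
qed

text \<open>The index sets are split by whether they contain N+1; the factor in front clears the
  denominator that this element contributes.\<close>

lemma macmahon_trunc_Suc:
  "(1 - fps_X ^ Suc N)\<^sup>2 * macmahon_trunc (Suc N) (Suc a) =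
     (1 - fps_X ^ Suc N)\<^sup>2 * macmahon_trunc N (Suc a) + fps_X ^ Suc N * macmahon_trunc N a"
proof -
  define A where "A = (\<lambda>a. {K. K \<subseteq> {1..N} \<and> card K = a})"
  have fin: "finite (A a)" for a
    by (rule finite_subset[of _ "Pow {1..N}"]) (auto simp: A_def)
  have finK: "finite K" "Suc N \<notin> K" if "K \<subseteq> {1..N}" for K
    using that finite_subset by auto
  have split: "{K. K \<subseteq> {1..Suc N} \<and> card K = Suc a} = A (Suc a) \<union> insert (Suc N) ` A a"
  proof (intro equalityI subsetI)
    fix K assume K: "K \<in> {K. K \<subseteq> {1..Suc N} \<and> card K = Suc a}"
    show "K \<in> A (Suc a) \<union> insert (Suc N) ` A a"
    proof (cases "Suc N \<in> K")
      case True
      have "finite K" using K finite_subset by auto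
      hence "K = insert (Suc N) (K - {Suc N})" "K - {Suc N} \<in> A a"
        using K True by (auto simp: A_def le_Suc_eq)
      thus ?thesis by blast
    next
      case False
      have "k \<le> N" if "k \<in> K" for k
      proof -
        have "k \<le> Suc N" "k \<noteq> Suc N" using K False that by auto
        thus ?thesis by simp
      qed
      thus ?thesis using K by (auto simp: A_def)
    qed
  qed (auto simp: A_def finK le_Suc_eq card_insert_if)
  have "macmahon_trunc (Suc N) (Suc a) =
      sum macmahon_term (A (Suc a)) + sum macmahon_term (insert (Suc N) ` A a)"
    unfolding macmahon_trunc_def split
    by (rule sum.union_disjoint) (use fin finK in \<open>auto simp: A_def\<close>)
  also have "sum macmahon_term (insert (Suc N) ` A a) = (\<Sum>K\<in>A a. macmahon_term (insert (Suc N) K))"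
    by (rule sum.reindex_cong[where l = "insert (Suc N)"])
      (auto simp only: A_def mem_Collect_eq intro!: inj_onI dest: insert_ident[OF finK(2) finK(2), THEN iffD1])
  finally have *: "(1 - fps_X ^ Suc N)\<^sup>2 * macmahon_trunc (Suc N) (Suc a)
      = (1 - fps_X ^ Suc N)\<^sup>2 * macmahon_trunc N (Suc a)
       + (\<Sum>K\<in>A a. (1 - fps_X ^ Suc N)\<^sup>2 * macmahon_term (insert (Suc N) K))"
    by (simp add: macmahon_trunc_def A_def algebra_simps sum_distrib_left)
  also have "(\<Sum>K\<in>A a. (1 - fps_X ^ Suc N)\<^sup>2 * macmahon_term (insert (Suc N) K))
     = (\<Sum>K\<in>A a. fps_X ^ Suc N * macmahon_term K)"
    by (intro sum.cong macmahon_term_insert refl) (auto simp: A_def finK dest: finK)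
  finally show ?thesis
    by (simp add: macmahon_trunc_def A_def sum_distrib_left)
qed

text \<open>The square of the q-factorial turns each summand into a product of q^k over k in K and
  (1 - q^k)^2 over the other k \<le> N. These are the terms at x^a in the product of (1 - q^k)^2 + x
  q^k.\<close>

lemma qpoch_macmahon_trunc: "(qpoch N)\<^sup>2 * macmahon_trunc N a = esym N a"
proof (induction N arbitrary: a)
  case 0
  have "macmahon_trunc 0 a = 0" if a: "a \<noteq> 0"
  proof -
    have "{K. K \<subseteq> {1..0::nat} \<and> card K = a} = {}" using a by auto
    thus ?thesis unfolding macmahon_trunc_def by (simp only: sum.empty)
  qed
  thus ?case by (simp add: macmahon_trunc_0)
next
  case (Suc N)
  have "(qpoch (Suc N))\<^sup>2 * macmahon_trunc (Suc N) (Suc a) =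
      (qpoch N)\<^sup>2 * ((1 - fps_X ^ Suc N)\<^sup>2 * macmahon_trunc (Suc N) (Suc a))" for a
    by (simp add: qpoch_Suc power_mult_distrib mult.assoc)
  also have "\<dots> a = esym (Suc N) (Suc a)" for a
    unfolding macmahon_trunc_Suc by (simp add: Suc[symmetric] algebra_simps)
  finally have *: "(qpoch (Suc N))\<^sup>2 * macmahon_trunc (Suc N) (Suc a) = esym (Suc N) (Suc a)" for a .
  show ?case
  proof (cases a)
    case 0
    thus ?thesis using Suc[of 0]
      by (simp add: macmahon_trunc_0 qpoch_Suc power_mult_distrib mult.commute)
  qed (use * in simp)
qed

text \<open>An index set with an element above N contributes only from q^(N+1) on.\<close>

lemma macmahon_U_cong: "fps_cong (Suc N) (macmahon_U a) (macmahon_trunc N a)"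
  unfolding fps_cong_nth
proof (intro allI impI)
  fix n assume n: "n < Suc N"
  define T where "T = {K. K \<subseteq> {1..N} \<and> card K = a}"
  have T: "finite T" "T \<subseteq> macmahon_index a"
    by (rule finite_subset[of _ "Pow {1..N}"])
      (auto simp: T_def macmahon_index_def dest: finite_subset)
  have vanish: "fps_nth (macmahon_term K) n = 0" if K: "K \<in> macmahon_index a" "K \<notin> T" for K
  proof -
    have K': "finite K" "\<forall>k\<in>K. 0 < k" using K by (auto simp: macmahon_index_def)
    obtain k where k: "k \<in> K" "N < k"
      using K by (force simp: T_def macmahon_index_def)
    hence "k \<le> (\<Sum>k\<in>K. k)" using K' by (intro member_le_sum) auto
    thus ?thesis using k n by (simp add: macmahon_term_eq[OF K'] fps_X_power_mult_nth)
  qed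
  have "(macmahon_term has_sum macmahon_U a) (macmahon_index a)"
    unfolding macmahon_U_def by (intro has_sum_infsum macmahon_summable)
  hence "\<forall>\<^sub>F A in finite_subsets_at_top (macmahon_index a).
            fps_nth (sum macmahon_term A) n = fps_nth (macmahon_U a) n"
    unfolding has_sum_def tendsto_fps_iff by (rule spec)
  then obtain X where X: "finite X" "X \<subseteq> macmahon_index a"
    "\<forall>Y. finite Y \<and> X \<subseteq> Y \<and> Y \<subseteq> macmahon_index a \<longrightarrow>
      fps_nth (sum macmahon_term Y) n = fps_nth (macmahon_U a) n"
    unfolding eventually_finite_subsets_at_top by (elim exE conjE)
  \<comment> \<open>Convergence fixes the coefficient for all finite sets above \<open>X\<close>.
    Adjoining \<open>T\<close> keeps it, and the members of \<open>X\<close> outside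
    \<open>T\<close> contribute 0.\<close>
  have "fps_nth (macmahon_U a) n = fps_nth (sum macmahon_term (X \<union> T)) n"
    using X(1,2) T by (intro X(3)[rule_format, symmetric] conjI) simp_all
  also have "\<dots> = fps_nth (sum macmahon_term T) n"
    unfolding fps_sum_nth by (intro sum.mono_neutral_right) (use X T vanish in auto)
  finally show "fps_nth (macmahon_U a) n = fps_nth (macmahon_trunc N a) n"
    by (simp add: macmahon_trunc_def T_def)
qed

text \<open>Modulo q^(N+1) the theta series is the cube of the q-factorial times the truncated U_a:
  one factor is used in \<open>jtp_cong\<close>, two clear denominators. The case a = 0 is Jacobi's
  identity for the cube, and multiplying it by U_a gives the case a.\<close>

lemma macmahon_U_tri_series:
  "macmahon_U a * tri_series (\<lambda>m. (- 1) ^ m * cheb m 0) = tri_series (\<lambda>m. (- 1) ^ m * cheb m a)"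
proof (rule fps_eqI_cong)
  fix N
  have tri: "fps_cong (Suc N) (tri_series (\<lambda>m. (- 1) ^ m * cheb m a)) (qpoch N ^ 3 * macmahon_trunc N a)" for a
  proof -
    have "fps_cong (Suc N) (\<Sum>m\<le>N. qpoch N * jtp N m * fps_const (cheb m a))
       (\<Sum>m\<le>N. fps_const ((- 1) ^ m) * fps_X ^ tri m * fps_const (cheb m a))"
      by (intro fps_cong_sum fps_cong_mult jtp_cong) auto
    also have "(\<Sum>m\<le>N. fps_const ((- 1) ^ m) * fps_X ^ tri m * fps_const (cheb m a))
       = (\<Sum>m\<le>N. fps_const ((- 1) ^ m * cheb m a) * fps_X ^ tri m)"
      by (simp add: mult_ac flip: fps_const_mult)
    also have "fps_cong (Suc N) \<dots> (tri_series (\<lambda>m. (- 1) ^ m * cheb m a))"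
      by (rule fps_cong_sym[OF tri_series_cong])
    also have "(\<Sum>m\<le>N. qpoch N * jtp N m * fps_const (cheb m a)) = qpoch N * esym N a"
      by (simp add: finite_jtp sum_distrib_left mult.assoc)
    also have "\<dots> = qpoch N ^ 3 * macmahon_trunc N a"
      by (simp add: qpoch_macmahon_trunc[symmetric] power3_eq_cube power2_eq_square)
    finally show ?thesis by (rule fps_cong_sym)
  qed
  have "fps_cong (Suc N) (macmahon_U a * tri_series (\<lambda>m. (- 1) ^ m * cheb m 0))
      (macmahon_trunc N a * (qpoch N ^ 3 * macmahon_trunc N 0))"
    by (intro fps_cong_mult macmahon_U_cong tri)
  also have "\<dots> = qpoch N ^ 3 * macmahon_trunc N a"
    by (simp add: macmahon_trunc_0)
  also have "fps_cong (Suc N) \<dots> (tri_series (\<lambda>m. (- 1) ^ m * cheb m a))"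
    by (rule fps_cong_sym[OF tri])
  finally show "fps_cong (Suc N) (macmahon_U a * tri_series (\<lambda>m. (- 1) ^ m * cheb m 0))
     (tri_series (\<lambda>m. (- 1) ^ m * cheb m a))" .
qed

section \<open>The first MacMahon series and the logarithmic derivative of eta^3\<close>

lemma macmahon_term_singleton:
  assumes "k > 0"
  shows "macmahon_term {k} = Abs_fps (\<lambda>n. if k dvd n then of_nat (n div k) else 0)" (is "_ = ?G")
proof -
  \<comment> \<open>\<open>H\<close> is the geometric series 1/(1 - q^k). Multiplying the claimed
    series by 1 - q^k gives q^k \<open>H\<close>, and a second time gives q^k.\<close>
  define H :: "rat fps" where "H = Abs_fps (\<lambda>n. if k dvd n then 1 else 0)"
  have dvd: "k dvd n - k \<longleftrightarrow> k dvd n" if "\<not> n < k" for n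
    using that by (simp add: dvd_minus_self)
  have "fps_nth (H * (1 - fps_X ^ k)) n = fps_nth 1 n" for n
    using assms dvd[of n]
    by (cases "n = 0") (auto simp: H_def algebra_simps fps_X_power_mult_nth dest: nat_dvd_not_less)
  hence H: "H * (1 - fps_X ^ k) = 1" by (simp add: fps_eq_iff)
  have "fps_nth (?G * (1 - fps_X ^ k)) n = fps_nth (fps_X ^ k * H) n" for n
    using assms dvd[of n]
    by (auto simp: H_def algebra_simps fps_X_power_mult_right_nth fps_X_power_mult_nth of_nat_diff
        le_div_geq)
  hence "?G * (1 - fps_X ^ k) = fps_X ^ k * H" by (simp add: fps_eq_iff)
  hence "?G * (1 - fps_X ^ k)\<^sup>2 = fps_X ^ k"
    using H by (simp add: power2_eq_square mult.assoc flip: mult.assoc[of ?G])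
  moreover have "macmahon_term {k} * (1 - fps_X ^ k)\<^sup>2 = fps_X ^ k"
    using macmahon_term_insert[of "{}" k] assms by (simp add: mult.commute macmahon_term_def)
  moreover have "(1 - fps_X ^ k :: rat fps)\<^sup>2 \<noteq> 0"
    using assms by (metis H mult_zero_right power_not_zero zero_neq_one)
  ultimately show ?thesis by (metis mult_right_cancel)
qed

lemma macmahon_U_1: "macmahon_U 1 = sigma_fps 1"
proof (rule fps_ext)
  fix n :: nat
  have "{K. K \<subseteq> {1..n} \<and> card K = 1} = (\<lambda>k. {k}) ` {1..n}"
    by (auto simp: card_1_singleton_iff)
  hence "macmahon_trunc n 1 = (\<Sum>k=1..n. macmahon_term {k})"
    unfolding macmahon_trunc_def by (simp add: sum.reindex inj_on_def)
  hence "fps_nth (macmahon_U 1) n = (\<Sum>k=1..n. if k dvd n then of_nat (n div k) else 0)"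
    using macmahon_U_cong[of n 1] by (simp add: fps_cong_nth macmahon_term_singleton fps_sum_nth)
  also have "\<dots> = fps_nth (sigma_fps 1) n"
  proof (cases "n = 0")
    case False
    have "(\<Sum>k=1..n. if k dvd n then of_nat (n div k) else (0 :: rat)) =
        (\<Sum>k\<in>{k \<in> {1..n}. k dvd n}. of_nat (n div k))"
      by (rule sum.inter_filter[symmetric]) simp
    also have "\<dots> = (\<Sum>d | d dvd n. of_nat d)"
      using False
      by (intro sum.reindex_bij_witness[where i = "\<lambda>d. n div d" and j = "\<lambda>d. n div d"])
        (auto simp: dvd_imp_le Suc_le_eq elim!: dvdE)
    finally show ?thesis using False by (simp add: sigma_fps_def sigma_def)
  qed (simp add: sigma_fps_def)
  finally show "fps_nth (macmahon_U 1) n = fps_nth (sigma_fps 1) n" .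
qed

text \<open>By Jacobi's identity this is \<open>q ^ (- 1 / 8)\<close> times the cube of Dedekind's eta function.\<close>
definition eta3 :: "rat fps" where
  "eta3 = tri_series (\<lambda>m. (- 1) ^ m * (2 * of_nat m + 1))"

lemma eta3_neq_0: "eta3 \<noteq> 0"
proof -
  have "tri m = 0 \<longleftrightarrow> m = 0" for m using le_tri[of m] by (cases m) auto
  hence "fps_nth eta3 0 = 1" by (simp add: eta3_def tri_series_def)
  thus ?thesis by auto
qed

text \<open>The case a = 1 of \<open>macmahon_U_tri_series\<close>: U_1 is the divisor series in E2,
  and \<open>cheb m 1\<close> is -1/3 times tri m times 2m+1, so the theta series on the right is a
  multiple of q d/dq of \<open>eta3\<close>. The - 1 reflects the missing factor q^(1/8).\<close>

lemma fps_XD_eta3: "8 * fps_XD eta3 = (E2 - 1) * eta3"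
proof -
  have c: "cheb m 1 = - (1 / 3) * of_nat (tri m) * (2 * of_nat m + 1)" for m
  proof -
    have "2 * of_nat (tri m) = (of_nat m * (of_nat m + 1) :: rat)"
      using arg_cong[OF two_tri[of m], of "of_nat :: nat \<Rightarrow> rat"] by (simp add: algebra_simps)
    moreover have "6 * cheb m 1 = - (of_nat m * (of_nat m + 1)) * (2 * of_nat m + 1)"
      using cheb_ratio[of 0 m] by (simp add: algebra_simps)
    ultimately have "6 * cheb m 1 = - (2 * of_nat (tri m)) * (2 * of_nat m + 1)" by (simp only:)
    thus ?thesis by simp
  qed
  have "sigma_fps 1 * eta3 = fps_const (- (1 / 3)) * fps_XD eta3"
    using macmahon_U_tri_series[of 1]
    unfolding macmahon_U_1 c cheb_0_right eta3_def fps_XD_tri_series tri_series_const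
    by (simp add: mult_ac)
  hence "24 * (sigma_fps 1 * eta3) = (24 * fps_const (- (1 / 3))) * fps_XD eta3"
    by (simp only: mult.assoc)
  also have "24 * fps_const (- (1 / 3)) = (- 8 :: rat fps)"
    by (simp add: numeral_fps_const flip: fps_const_neg)
  finally show ?thesis by (simp add: E2_def algebra_simps)
qed

section \<open>Convolution sums of divisor functions\<close>

text \<open>Here a and b are divisors of two positive summands of n, and x and y are their
  cofactors.\<close>

definition quads :: "nat \<Rightarrow> (nat \<times> nat \<times> nat \<times> nat) set" where
  "quads n = {(a, b, x, y). 0 < a \<and> 0 < b \<and> 0 < x \<and> 0 < y \<and> a * x + b * y = n}"

lemma finite_quads: "finite (quads n)"
proof (rule finite_subset)
  show "quads n \<subseteq> {..n} \<times> {..n} \<times> {..n} \<times> {..n}"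
  proof safe
    fix a b x y assume "(a, b, x, y) \<in> quads n"
    hence pos: "0 < a" "0 < b" "0 < x" "0 < y" and n: "a * x + b * y = n" by (auto simp: quads_def)
    have "a \<le> a * x" "x \<le> a * x" "b \<le> b * y" "y \<le> b * y" using pos by auto
    thus "a \<le> n" "b \<le> n" "x \<le> n" "y \<le> n" using n by linarith+
  qed
qed auto

lemma quads_sum_split:
  fixes f :: "nat \<times> nat \<times> nat \<times> nat \<Rightarrow> rat" and u v :: "nat \<times> nat \<times> nat \<times> nat \<Rightarrow> nat"
  shows "sum f (quads n) = sum f {z \<in> quads n. u z > v z} + sum f {z \<in> quads n. u z < v z}
          + sum f {z \<in> quads n. u z = v z}"
proof -
  have "quads n = ({z \<in> quads n. u z > v z} \<union> {z \<in> quads n. u z < v z}) \<union> {z \<in> quads n. u z = v z}"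
    by auto
  also have "sum f \<dots> = sum f ({z \<in> quads n. u z > v z} \<union> {z \<in> quads n. u z < v z}) + sum f {z \<in> quads n. u z = v z}"
    by (rule sum.union_disjoint) (auto simp: finite_quads)
  also have "sum f ({z \<in> quads n. u z > v z} \<union> {z \<in> quads n. u z < v z})
     = sum f {z \<in> quads n. u z > v z} + sum f {z \<in> quads n. u z < v z}"
    by (rule sum.union_disjoint) (auto simp: finite_quads)
  finally show ?thesis .
qed

text \<open>If x = y, then (a + b) x = n, so d = a + b is a divisor of n that determines x.\<close>

lemma quads_sum_diag:
  assumes n: "n > 0"
  shows "(\<Sum>(a, b, x, y)\<in>{(a, b, x, y) \<in> quads n. x = y}. f a b :: rat)
         = (\<Sum>d | d dvd n. \<Sum>a=1..<d. f a (d - a))"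
proof -
  have "(\<Sum>d | d dvd n. \<Sum>a=1..<d. f a (d - a)) = (\<Sum>(d, a)\<in>(SIGMA d:{d. d dvd n}. {1..<d}). f a (d - a))"
    by (rule sum.Sigma) (use n in auto)
  also have "\<dots> = (\<Sum>(a, b, x, y)\<in>{(a, b, x, y) \<in> quads n. x = y}. f a b)"
  proof (rule sum.reindex_bij_witness[where i = "\<lambda>(a, b, x, y). (a + b, a)"
          and j = "\<lambda>(d, a). (a, d - a, n div d, n div d)"], goal_cases)
    case (2 z)
    then obtain d a where z: "z = (d, a)" "d dvd n" "0 < a" "a < d" by auto
    have "a * (n div d) + (d - a) * (n div d) = d * (n div d)"
      using z by (simp flip: add_mult_distrib)
    thus ?case using z n by (simp add: quads_def div_greater_zero_iff dvd_imp_le)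
  next
    case (3 z)
    then obtain a b x where z: "z = (a, b, x, x)" "0 < a" "0 < b" "n = (a + b) * x"
      by (auto simp: quads_def add_mult_distrib)
    thus ?case by simp
  next
    case (4 z)
    thus ?case by (auto simp: quads_def simp flip: add_mult_distrib)
  qed auto
  finally show ?thesis ..
qed

text \<open>If a = b = d, then x + y = n/d, which has n/d - 1 positive solutions.\<close>

lemma quads_sum_diag':
  assumes n: "n > 0"
  shows "(\<Sum>(a, b, x, y)\<in>{(a, b, x, y) \<in> quads n. a = b}. f a :: rat)
         = (\<Sum>d | d dvd n. (of_nat (n div d) - 1) * f d)"
proof -
  have "(\<Sum>d | d dvd n. (of_nat (n div d) - 1) * f d) = (\<Sum>d | d dvd n. \<Sum>x=1..<n div d. f d)"
    using n by (intro sum.cong refl) (auto simp: of_nat_diff Suc_le_eq div_greater_zero_iff dvd_imp_le)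
  also have "\<dots> = (\<Sum>(d, x)\<in>(SIGMA d:{d. d dvd n}. {1..<n div d}). f d)"
    by (rule sum.Sigma) (use n in auto)
  also have "\<dots> = (\<Sum>(a, b, x, y)\<in>{(a, b, x, y) \<in> quads n. a = b}. f a)"
  proof (rule sum.reindex_bij_witness[where i = "\<lambda>(a, b, x, y). (a, x)"
          and j = "\<lambda>(d, x). (d, d, x, n div d - x)"], goal_cases)
    case (2 z)
    then obtain d x where z: "z = (d, x)" "d dvd n" "0 < x" "x < n div d" by auto
    have "d * x + d * (n div d - x) = d * (n div d)"
      using z by (simp flip: add_mult_distrib2)
    thus ?case using z n by (auto simp: quads_def dvd_imp_le intro!: Nat.gr0I)
  next
    case (3 z)
    then obtain a x y where z: "z = (a, a, x, y)" "0 < a" "n = a * (x + y)"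
      by (auto simp: quads_def add_mult_distrib2)
    thus ?case by simp
  next
    case (4 z)
    then obtain a x y where z: "z = (a, a, x, y)" "0 < a" "0 < x" "0 < y" "n = a * (x + y)"
      by (auto simp: quads_def add_mult_distrib2)
    thus ?case by simp
  qed auto
  finally show ?thesis ..
qed

text \<open>
  The substitution \<open>a x + b y = a (x - y) + (a + b) y\<close> for \<open>x > y\<close> and its mirror image
  for \<open>x < y\<close> exchange the two off-diagonal parts of the sum.
\<close>
lemma quads_sum_symmetry:
  fixes h k :: "nat \<Rightarrow> nat \<Rightarrow> rat"
  assumes n: "n > 0"
    and h1: "\<And>a b. a > 0 \<Longrightarrow> b > 0 \<Longrightarrow> k a (a + b) = h a b"
    and h2: "\<And>a b. a > 0 \<Longrightarrow> b > 0 \<Longrightarrow> k (a + b) b = h a b"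
  shows "(\<Sum>(a, b, x, y)\<in>quads n. h a b - k a b) =
    (\<Sum>d | d dvd n. (\<Sum>a=1..<d. h a (d - a)) - (of_nat (n div d) - 1) * k d d)"
proof -
  define H where "H = (\<lambda>(a, b, x :: nat, y :: nat). h a b)"
  define K where "K = (\<lambda>(a, b, x :: nat, y :: nat). k a b)"
  have gt: "sum H {(a, b, x, y) \<in> quads n. x > y} = sum K {(a, b, x, y) \<in> quads n. a < b}"
    by (rule sum.reindex_bij_witness[where j = "\<lambda>(a, b, x, y). (a, a + b, x - y, y)"
          and i = "\<lambda>(a, b, x, y). (a, b - a, x + y, y)"])
      (auto simp: quads_def H_def K_def h1[of "Suc a" "Suc b" for a b, simplified] algebra_simps less_iff_Suc_add)
  have lt: "sum H {(a, b, x, y) \<in> quads n. x < y} = sum K {(a, b, x, y) \<in> quads n. a > b}"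
    by (rule sum.reindex_bij_witness[where j = "\<lambda>(a, b, x, y). (a + b, b, x, y - x)"
          and i = "\<lambda>(a, b, x, y). (a - b, b, x, x + y)"])
      (auto simp: quads_def H_def K_def h2[of "Suc a" "Suc b" for a b, simplified] algebra_simps less_iff_Suc_add)
  have "sum H (quads n) = sum H {(a, b, x, y) \<in> quads n. x > y} + sum H {(a, b, x, y) \<in> quads n. x < y}
      + sum H {(a, b, x, y) \<in> quads n. x = y}"
    using quads_sum_split[of H n "\<lambda>(a, b, x, y). x" "\<lambda>(a, b, x, y). y"]
    by (simp add: case_prod_unfold eq_commute)
  moreover have "sum K (quads n) = sum K {(a, b, x, y) \<in> quads n. a > b} + sum K {(a, b, x, y) \<in> quads n. a < b}
      + sum K {(a, b, x, y) \<in> quads n. a = b}"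
    using quads_sum_split[of K n "\<lambda>(a, b, x, y). a" "\<lambda>(a, b, x, y). b"]
    by (simp add: case_prod_unfold eq_commute)
  ultimately have "sum H (quads n) - sum K (quads n) =
      sum H {(a, b, x, y) \<in> quads n. x = y} - sum K {(a, b, x, y) \<in> quads n. a = b}"
    by (simp add: gt lt)
  also have "sum H {(a, b, x, y) \<in> quads n. x = y} = (\<Sum>d | d dvd n. \<Sum>a=1..<d. h a (d - a))"
    unfolding H_def by (rule quads_sum_diag[OF n])
  also have "sum K {(a, b, x, y) \<in> quads n. a = b} =
      (\<Sum>(a, b, x, y)\<in>{(a, b, x, y) \<in> quads n. a = b}. k a a)"
    unfolding K_def by (rule sum.cong) auto
  also have "\<dots> = (\<Sum>d | d dvd n. (of_nat (n div d) - 1) * k d d)"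
    by (rule quads_sum_diag'[OF n])
  finally show ?thesis
    by (simp add: H_def K_def case_prod_unfold sum_subtractf)
qed

lemma sigma_fps_mult_nth:
  "fps_nth (sigma_fps i * sigma_fps j) n = (\<Sum>(a, b, x, y)\<in>quads n. of_nat a ^ i * of_nat b ^ j)"
proof -
  \<comment> \<open>Every number divides 0, whereas \<open>sigma_fps\<close> has constant term 0;
    hence the empty set at m = 0.\<close>
  define D where "D = (\<lambda>m::nat. if m = 0 then {} else {d. d dvd m})"
  have fin: "finite (D m)" for m by (simp add: D_def)
  have nth: "fps_nth (sigma_fps i) m = (\<Sum>d\<in>D m. of_nat d ^ i)" for i m
    by (simp add: sigma_fps_def sigma_def D_def)
  have "fps_nth (sigma_fps i * sigma_fps j) n
      = (\<Sum>m=0..n. (\<Sum>a\<in>D m. of_nat a ^ i) * (\<Sum>b\<in>D (n - m). of_nat b ^ j))"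
    by (simp add: fps_mult_nth nth)
  also have "\<dots> = (\<Sum>m=0..n. \<Sum>(a, b)\<in>D m \<times> D (n - m). of_nat a ^ i * of_nat b ^ j)"
    by (simp add: sum_product sum.cartesian_product)
  also have "\<dots> = (\<Sum>(m, a, b)\<in>(SIGMA m:{0..n}. D m \<times> D (n - m)). of_nat a ^ i * of_nat b ^ j)"
    using fin by (subst sum.Sigma) (auto simp: case_prod_unfold)
  also have "\<dots> = (\<Sum>(a, b, x, y)\<in>quads n. of_nat a ^ i * of_nat b ^ j)"
  proof (rule sum.reindex_bij_witness[where j = "\<lambda>(m, a, b). (a, b, m div a, (n - m) div b)"
          and i = "\<lambda>(a, b, x, y). (a * x, a, b)"], goal_cases)
    case (1 z)
    thus ?case by (auto simp: D_def split: if_splits)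
  next
    case (2 z)
    then obtain m a b where z: "z = (m, a, b)" "m \<le> n" "m > 0" "n - m > 0" "a dvd m" "b dvd n - m"
      by (auto simp: D_def split: if_splits)
    have "a > 0" "b > 0" using z by (auto intro!: Nat.gr0I)
    thus ?case using z by (simp add: quads_def div_greater_zero_iff dvd_imp_le)
  next
    case (3 z)
    thus ?case by (auto simp: quads_def)
  next
    case (4 z)
    thus ?case by (auto simp: quads_def D_def)
  next
    case (5 z)
    thus ?case by auto
  qed
  finally show ?thesis .
qed

text \<open>
  The substitution is a cyclic shift of the triple \<open>(u, v, - u - v)\<close> up to sign, so symmetric
  polynomials of even degree in this triple satisfy the hypothesis.
\<close>
lemma quads_sum_cyclic:
  fixes p :: "rat \<Rightarrow> rat \<Rightarrow> rat"
  assumes n: "n > 0" and sym: "\<And>u v. p (u + v) (- u) = p u v"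
  shows "(\<Sum>(a, b, x, y)\<in>quads n. p (of_nat a) (of_nat b) - p (of_nat a) (of_nat b - of_nat a)) =
    (\<Sum>d | d dvd n. (\<Sum>a<d. p (of_nat a) (of_nat d - of_nat a)) - of_nat (n div d) * p (of_nat d) 0)"
proof -
  have "(\<Sum>(a, b, x, y)\<in>quads n. p (of_nat a) (of_nat b) - p (of_nat a) (of_nat b - of_nat a)) =
    (\<Sum>d | d dvd n. (\<Sum>a=1..<d. p (of_nat a) (of_nat (d - a)))
        - (of_nat (n div d) - 1) * p (of_nat d) (of_nat d - of_nat d))"
  proof (rule quads_sum_symmetry[OF n])
    fix a b :: nat
    have "p (of_nat b + of_nat a) (- of_nat a) = p (of_nat a) (of_nat b)"
      using sym[of "of_nat a" "of_nat b"] by (simp add: add.commute)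
    thus "p (of_nat (a + b)) (of_nat b - of_nat (a + b)) = p (of_nat a) (of_nat b)"
      by (simp add: add.commute)
  qed simp
  \<comment> \<open>Extending the inner sum to a = 0 adds p(0, d) = p(d, 0), which absorbs the - 1
    in n/d - 1.\<close>
  also have "\<dots> = (\<Sum>d | d dvd n. (\<Sum>a<d. p (of_nat a) (of_nat d - of_nat a)) - of_nat (n div d) * p (of_nat d) 0)"
  proof (intro sum.cong refl)
    fix d assume "d \<in> {d. d dvd n}"
    hence "d > 0" using n by (auto intro!: Nat.gr0I)
    hence "{..<d} = insert 0 {1..<d}" by auto
    hence "(\<Sum>a<d. p (of_nat a) (of_nat d - of_nat a)) =
        p 0 (of_nat d) + (\<Sum>a=1..<d. p (of_nat a) (of_nat (d - a)))"
      by (simp add: of_nat_diff)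
    moreover have "p 0 (of_nat d) = p (of_nat d) 0"
      using sym[of 0 "of_nat d"] by simp
    ultimately show "(\<Sum>a=1..<d. p (of_nat a) (of_nat (d - a)))
        - (of_nat (n div d) - 1) * p (of_nat d) (of_nat d - of_nat d) =
        (\<Sum>a<d. p (of_nat a) (of_nat d - of_nat a)) - of_nat (n div d) * p (of_nat d) 0"
      by (simp add: algebra_simps)
  qed
  finally show ?thesis .
qed

text \<open>Summing an odd polynomial in d over the divisors of n gives divisor functions. The
  boundary term (n/d) d^(w+1) = n d^w gives a coefficient of q d/dq of
  \<open>sigma_fps w\<close>.\<close>

lemma quads_sum_cyclic_sigma:
  fixes p :: "rat \<Rightarrow> rat \<Rightarrow> rat"
  assumes sym: "\<And>u v. p (u + v) (- u) = p u v"
    and sum: "\<And>d. (\<Sum>a<d. p (of_nat a) (of_nat d - of_nat a)) =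
       c1 * of_nat d + c3 * of_nat d ^ 3 + c5 * of_nat d ^ 5 + c7 * of_nat d ^ 7"
    and zero: "\<And>d. p d 0 = e * d ^ Suc w"
  shows "(\<Sum>(a, b, x, y)\<in>quads n. p (of_nat a) (of_nat b) - p (of_nat a) (of_nat b - of_nat a)) =
    c1 * fps_nth (sigma_fps 1) n + c3 * fps_nth (sigma_fps 3) n + c5 * fps_nth (sigma_fps 5) n
      + c7 * fps_nth (sigma_fps 7) n - e * (of_nat n * fps_nth (sigma_fps w) n)"
proof (cases "n = 0")
  case True
  hence "quads n = {}" by (auto simp: quads_def)
  thus ?thesis using True by (simp add: sigma_fps_def)
next
  case False
  have "of_nat (n div d) * p (of_nat d) 0 = e * (of_nat n * of_nat d ^ w)" if "d dvd n" for d
    using that by (auto simp: zero elim!: dvdE)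
  hence "(\<Sum>d | d dvd n. (\<Sum>a<d. p (of_nat a) (of_nat d - of_nat a)) - of_nat (n div d) * p (of_nat d) 0)
     = (\<Sum>d | d dvd n. c1 * of_nat d + c3 * of_nat d ^ 3 + c5 * of_nat d ^ 5 + c7 * of_nat d ^ 7
          - e * (of_nat n * of_nat d ^ w))"
    by (intro sum.cong refl) (simp add: sum)
  with quads_sum_cyclic[of n p, OF _ sym] show ?thesis using False
    by (simp add: sigma_fps_def sigma_def sum.distrib sum_subtractf sum_distrib_left)
qed

lemma quads_sum_monom:
  "(\<Sum>(a, b, x, y)\<in>quads n. c * (of_nat a ^ i * of_nat b ^ j)) =
     c * fps_nth (sigma_fps i * sigma_fps j) n"
  by (simp add: sigma_fps_mult_nth case_prod_unfold sum_distrib_left)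

lemma quads_sum_add:
  fixes f g :: "nat \<Rightarrow> nat \<Rightarrow> rat"
  shows "(\<Sum>(a, b, x, y)\<in>quads n. f a b + g a b) =
    (\<Sum>(a, b, x, y)\<in>quads n. f a b) + (\<Sum>(a, b, x, y)\<in>quads n. g a b)"
  by (simp add: case_prod_unfold sum.distrib)

section \<open>Power sums and the explicit convolution identities\<close>

lemma sum_powers:
  fixes n :: nat
  shows sum_powers_1: "(\<Sum>a<n. of_nat a) = (of_nat n ^ 2 / 2 - of_nat n / 2 :: rat)"
    and sum_powers_2: "(\<Sum>a<n. of_nat a ^ 2) = (of_nat n ^ 3 / 3 - of_nat n ^ 2 / 2 + of_nat n / 6 :: rat)"
    and sum_powers_3: "(\<Sum>a<n. of_nat a ^ 3) = (of_nat n ^ 4 / 4 - of_nat n ^ 3 / 2 + of_nat n ^ 2 / 4 :: rat)"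
    and sum_powers_4: "(\<Sum>a<n. of_nat a ^ 4) =
      (of_nat n ^ 5 / 5 - of_nat n ^ 4 / 2 + of_nat n ^ 3 / 3 - of_nat n / 30 :: rat)"
    and sum_powers_5: "(\<Sum>a<n. of_nat a ^ 5) =
      (of_nat n ^ 6 / 6 - of_nat n ^ 5 / 2 + 5 * of_nat n ^ 4 / 12 - of_nat n ^ 2 / 12 :: rat)"
    and sum_powers_6: "(\<Sum>a<n. of_nat a ^ 6) =
      (of_nat n ^ 7 / 7 - of_nat n ^ 6 / 2 + of_nat n ^ 5 / 2 - of_nat n ^ 3 / 6 + of_nat n / 42 :: rat)"
  by (induction n; simp add: field_simps eval_nat_numeral)+

text \<open>The invariant of degree 2 is u^2 + u v + v^2, half the sum of the squares of u, v, -u-v.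
  Its difference under b -> b - a is 2ab.\<close>

lemma sigma_1_sigma_1:
  "12 * (sigma_fps 1 * sigma_fps 1) = 5 * sigma_fps 3 + sigma_fps 1 - 6 * fps_XD (sigma_fps 1)"
proof (rule fps_ext)
  fix n
  define p where "p = (\<lambda>u v :: rat. u\<^sup>2 + u * v + v\<^sup>2)"
  have sym: "p (u + v) (- u) = p u v" for u v
    unfolding p_def by algebra
  have zero: "p d 0 = 1 * d ^ Suc 1" for d
    by (simp add: p_def eval_nat_numeral)
  \<comment> \<open>The constants come from expanding p(a, d - a) in powers of a and applying
    \<open>sum_powers\<close>; the even powers of d cancel.\<close>
  have s: "(\<Sum>a<d. p (of_nat a) (of_nat d - of_nat a)) =
      1/6 * of_nat d + 5/6 * of_nat d ^ 3 + 0 * of_nat d ^ 5 + 0 * of_nat d ^ 7" for d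
  proof -
    have "p (of_nat a) (of_nat d - of_nat a) = of_nat d ^ 2 - of_nat d * of_nat a + of_nat a ^ 2" for a
      by (simp add: p_def algebra_simps power2_eq_square)
    thus ?thesis
      by (simp add: sum.distrib sum_subtractf sum_powers flip: sum_distrib_left)
        (simp add: field_simps eval_nat_numeral)
  qed
  have d: "p a b - p a (b - a) = 2 * (a ^ 1 * b ^ 1)" for a b
    by (simp add: p_def algebra_simps power2_eq_square)
  have "2 * fps_nth (sigma_fps 1 * sigma_fps 1) n
    = 1/6 * fps_nth (sigma_fps 1) n + 5/6 * fps_nth (sigma_fps 3) n - of_nat n * fps_nth (sigma_fps 1) n"
    using quads_sum_cyclic_sigma[of p "1/6" "5/6" 0 0 1 1 n, OF sym s zero]
    unfolding d quads_sum_add quads_sum_monom by simp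
  thus "fps_nth (12 * (sigma_fps 1 * sigma_fps 1)) n =
      fps_nth (5 * sigma_fps 3 + sigma_fps 1 - 6 * fps_XD (sigma_fps 1)) n"
    by (simp add: numeral_fps_const mult.assoc)
qed

lemma sigma_1_sigma_3:
  "240 * (sigma_fps 1 * sigma_fps 3) =
     21 * sigma_fps 5 + 10 * sigma_fps 3 - sigma_fps 1 - 30 * fps_XD (sigma_fps 3)"
proof (rule fps_ext)
  fix n
  define p where "p = (\<lambda>u v :: rat. (u\<^sup>2 + u * v + v\<^sup>2) ^ 2)"
  have sym: "p (u + v) (- u) = p u v" for u v
    unfolding p_def by algebra
  have zero: "p d 0 = 1 * d ^ Suc 3" for d
    by (simp add: p_def eval_nat_numeral)
  have s: "(\<Sum>a<d. p (of_nat a) (of_nat d - of_nat a)) =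
      (-1/30) * of_nat d + 1/3 * of_nat d ^ 3 + 7/10 * of_nat d ^ 5 + 0 * of_nat d ^ 7" for d
  proof -
    have "p (of_nat a) (of_nat d - of_nat a) = of_nat d ^ 4 - 2 * of_nat d ^ 3 * of_nat a
        + 3 * of_nat d ^ 2 * of_nat a ^ 2 - 2 * of_nat d * of_nat a ^ 3 + of_nat a ^ 4" for a
      unfolding p_def by (algebra)
    thus ?thesis
      by (simp add: sum.distrib sum_subtractf sum_powers flip: sum_distrib_left)
        (simp add: field_simps eval_nat_numeral)
  qed
  have d: "p a b - p a (b - a) = 4 * (a ^ 1 * b ^ 3) + 4 * (a ^ 3 * b ^ 1)" for a b
    unfolding p_def by algebra
  have "8 * fps_nth (sigma_fps 1 * sigma_fps 3) n
    = 4 * fps_nth (sigma_fps 1 * sigma_fps 3) n + 4 * fps_nth (sigma_fps 3 * sigma_fps 1) n"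
    by (simp add: mult.commute)
  also have "\<dots>
    = (-1/30) * fps_nth (sigma_fps 1) n + 1/3 * fps_nth (sigma_fps 3) n + 7/10 * fps_nth (sigma_fps 5) n
      - of_nat n * fps_nth (sigma_fps 3) n"
    using quads_sum_cyclic_sigma[of p "-1/30" "1/3" "7/10" 0 1 3 n, OF sym s zero]
    unfolding d quads_sum_add quads_sum_monom by simp
  finally show "fps_nth (240 * (sigma_fps 1 * sigma_fps 3)) n =
     fps_nth (21 * sigma_fps 5 + 10 * sigma_fps 3 - sigma_fps 1 - 30 * fps_XD (sigma_fps 3)) n"
    by (simp add: numeral_fps_const mult.assoc)
qed

text \<open>The invariant is the square of u v (u + v). It vanishes at v = 0, so no derivative
  occurs; the identity amounts to E_4^2 = E_8.\<close>

lemma sigma_3_sigma_3: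
  "120 * (sigma_fps 3 * sigma_fps 3) = sigma_fps 7 - sigma_fps 3"
proof (rule fps_ext)
  fix n
  define p where "p = (\<lambda>u v :: rat. (u * v * (u + v)) ^ 2)"
  have sym: "p (u + v) (- u) = p u v" for u v
    unfolding p_def by algebra
  \<comment> \<open>Since p(d, 0) = 0, the coefficient e is 0 and the exponent is an arbitrary
    choice.\<close>
  have zero: "p d 0 = 0 * d ^ Suc 0" for d
    by (simp add: p_def eval_nat_numeral)
  have s: "(\<Sum>a<d. p (of_nat a) (of_nat d - of_nat a)) =
      0 * of_nat d + (-1/30) * of_nat d ^ 3 + 0 * of_nat d ^ 5 + 1/30 * of_nat d ^ 7" for d
  proof -
    have "p (of_nat a) (of_nat d - of_nat a) =
        of_nat d ^ 4 * of_nat a ^ 2 - 2 * of_nat d ^ 3 * of_nat a ^ 3 + of_nat d ^ 2 * of_nat a ^ 4" for a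
      unfolding p_def by algebra
    thus ?thesis
      by (simp add: sum.distrib sum_subtractf sum_powers flip: sum_distrib_left)
        (simp add: field_simps eval_nat_numeral)
  qed
  have d: "p a b - p a (b - a) = 4 * (a ^ 3 * b ^ 3)" for a b
    unfolding p_def by algebra
  have "4 * fps_nth (sigma_fps 3 * sigma_fps 3) n
    = (-1/30) * fps_nth (sigma_fps 3) n + 1/30 * fps_nth (sigma_fps 7) n"
    using quads_sum_cyclic_sigma[of p 0 "-1/30" 0 "1/30" 0 0 n, OF sym s zero]
    unfolding d quads_sum_add quads_sum_monom by simp
  thus "fps_nth (120 * (sigma_fps 3 * sigma_fps 3)) n = fps_nth (sigma_fps 7 - sigma_fps 3) n"
    by (simp add: numeral_fps_const mult.assoc)
qed

text \<open>The cube of the quadratic invariant also produces a^3 b^3, which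
  \<open>sigma_3_sigma_3\<close> removes.\<close>

lemma sigma_1_sigma_5:
  "504 * (sigma_fps 1 * sigma_fps 5) =
     20 * sigma_fps 7 + 21 * sigma_fps 5 + sigma_fps 1 - 42 * fps_XD (sigma_fps 5)"
proof (rule fps_ext)
  fix n
  define p where "p = (\<lambda>u v :: rat. (u\<^sup>2 + u * v + v\<^sup>2) ^ 3)"
  have sym: "p (u + v) (- u) = p u v" for u v
    unfolding p_def by algebra
  have zero: "p d 0 = 1 * d ^ Suc 5" for d
    by (simp add: p_def eval_nat_numeral)
  have s: "(\<Sum>a<d. p (of_nat a) (of_nat d - of_nat a)) =
      1/42 * of_nat d + (-7/60) * of_nat d ^ 3 + 1/2 * of_nat d ^ 5 + 83/140 * of_nat d ^ 7" for d
  proof -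
    have "p (of_nat a) (of_nat d - of_nat a) = of_nat d ^ 6 - 3 * of_nat d ^ 5 * of_nat a
        + 6 * of_nat d ^ 4 * of_nat a ^ 2 - 7 * of_nat d ^ 3 * of_nat a ^ 3
        + 6 * of_nat d ^ 2 * of_nat a ^ 4 - 3 * of_nat d * of_nat a ^ 5 + of_nat a ^ 6" for a
      unfolding p_def by algebra
    thus ?thesis
      by (simp add: sum.distrib sum_subtractf sum_powers flip: sum_distrib_left)
        (simp add: field_simps eval_nat_numeral)
  qed
  have d: "p a b - p a (b - a) = 6 * (a ^ 1 * b ^ 5) + 6 * (a ^ 5 * b ^ 1) + 14 * (a ^ 3 * b ^ 3)" for a b
    unfolding p_def by algebra
  have "12 * fps_nth (sigma_fps 1 * sigma_fps 5) n + 14 * fps_nth (sigma_fps 3 * sigma_fps 3) n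
    = 6 * fps_nth (sigma_fps 1 * sigma_fps 5) n + 6 * fps_nth (sigma_fps 5 * sigma_fps 1) n
      + 14 * fps_nth (sigma_fps 3 * sigma_fps 3) n"
    by (simp add: mult.commute)
  also have "\<dots> = 1/42 * fps_nth (sigma_fps 1) n + (-7/60) * fps_nth (sigma_fps 3) n
      + 1/2 * fps_nth (sigma_fps 5) n + 83/140 * fps_nth (sigma_fps 7) n
      - of_nat n * fps_nth (sigma_fps 5) n"
    using quads_sum_cyclic_sigma[of p "1/42" "-7/60" "1/2" "83/140" 1 5 n, OF sym s zero]
    unfolding d quads_sum_add quads_sum_monom by simp
  moreover have "120 * fps_nth (sigma_fps 3 * sigma_fps 3) n = fps_nth (sigma_fps 7) n - fps_nth (sigma_fps 3) n"
    using arg_cong[OF sigma_3_sigma_3, of "\<lambda>f. fps_nth f n"] by (simp add: numeral_fps_const)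
  ultimately show "fps_nth (504 * (sigma_fps 1 * sigma_fps 5)) n =
     fps_nth (20 * sigma_fps 7 + 21 * sigma_fps 5 + sigma_fps 1 - 42 * fps_XD (sigma_fps 5)) n"
    by (simp add: numeral_fps_const mult.assoc)
qed

section \<open>Ramanujan's differential equations\<close>

lemma fps_XD_numeral_mult [simp]: "fps_XD (numeral k * f) = numeral k * (fps_XD f :: rat fps)"
  by (simp add: numeral_fps_const)

lemma fps_XD_diff [simp]: "fps_XD (f - g) = fps_XD f - (fps_XD g :: rat fps)"
  by (simp add: fps_XD_def algebra_simps)

lemma fps_XD_1 [simp]: "fps_XD (1 :: rat fps) = 0"
  by (simp add: fps_XD_def)

lemma ramanujan_E2: "12 * fps_XD E2 = E2\<^sup>2 - E4"
proof -
  have "fps_XD E2 = - 24 * fps_XD (sigma_fps 1)" by (simp add: E2_def)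
  thus ?thesis using sigma_1_sigma_1 unfolding E2_def E4_def by algebra
qed

lemma ramanujan_E4: "3 * fps_XD E4 = E2 * E4 - E6"
proof -
  have "fps_XD E4 = 240 * fps_XD (sigma_fps 3)" by (simp add: E4_def)
  thus ?thesis using sigma_1_sigma_3 unfolding E2_def E4_def E6_def by algebra
qed

text \<open>The contributions of \<open>sigma_fps 7\<close> to E2 E6 and to E4^2 cancel.\<close>

lemma ramanujan_E6: "2 * fps_XD E6 = E2 * E6 - E4\<^sup>2"
proof -
  have "fps_XD E6 = - 504 * fps_XD (sigma_fps 5)" by (simp add: E6_def)
  thus ?thesis using sigma_1_sigma_5 sigma_3_sigma_3 unfolding E2_def E4_def E6_def by algebra
qed

section \<open>The weights\<close>

text \<open>The weights are elementary symmetric polynomials in the numbers 1/(2l+1)^2, up to a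
  factor that does not depend on t.\<close>

lemma weight_w_sum:
  "(\<Sum>t=0..a. weight_w t a * y ^ t) =
     of_nat ((2 * a) choose a) / (16 ^ a * (2 * of_nat a + 1)) *
       (\<Prod>l<a. 1 + y / (2 * of_nat l + 1)\<^sup>2)"
proof -
  define z where "z = (\<lambda>l::nat. 1 / (2 * of_nat l + 1 :: rat)\<^sup>2)"
  have "(\<Prod>l<a. 1 + y * z l) = (\<Prod>l<a. y * z l + 1)"
    by (simp add: add.commute)
  also have "\<dots> = (\<Sum>L\<in>Pow {..<a}. \<Prod>l\<in>L. y * z l)"
    by (simp add: prod_add)
  also have "\<dots> = (\<Sum>L\<in>Pow {..<a}. y ^ card L * (\<Prod>l\<in>L. z l))"
    by (simp add: prod.distrib)
  also have "\<dots> = (\<Sum>t\<in>{0..a}. \<Sum>L\<in>{L \<in> Pow {..<a}. card L = t}. y ^ card L * (\<Prod>l\<in>L. z l))"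
    by (rule sum.group[symmetric]) (use card_mono[of "{..<a}"] in auto)
  also have "\<dots> = (\<Sum>t=0..a. y ^ t * (\<Sum>L | L \<subseteq> {..<a} \<and> card L = t. \<Prod>l\<in>L. z l))"
    by (simp add: sum_distrib_left)
  finally show ?thesis
    by (simp add: weight_w_def z_def sum_distrib_left mult_ac)
qed

lemma central_binomial_Suc:
  "(of_nat a + 1) * of_nat ((2 * Suc a) choose Suc a) = (2 * (2 * of_nat a + 1) * of_nat ((2 * a) choose a) :: rat)"
proof -
  have sym: "Suc (2 * a) choose a = Suc (2 * a) choose Suc a"
    using binomial_symmetric[of a "Suc (2 * a)"] by simp
  have "Suc a * (Suc (2 * a) choose Suc a) = Suc (2 * a) * ((2 * a) choose a)"
    by (rule Suc_times_binomial)
  moreover have "(2 * Suc a) choose Suc a = 2 * (Suc (2 * a) choose Suc a)"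
    using sym by (simp add: binomial_Suc_Suc[of "Suc (2 * a)" a] del: binomial_Suc_Suc)
  ultimately have "Suc a * ((2 * Suc a) choose Suc a) = 2 * (Suc (2 * a) * ((2 * a) choose a))"
    by (metis mult.left_commute)
  from arg_cong[OF this, of "of_nat :: nat \<Rightarrow> rat"] show ?thesis
    by (simp add: add_ac mult.assoc del: binomial_Suc_Suc mult_Suc_right mult_Suc)
qed

text \<open>The new factor in the induction is 4(a-m)(a+m+1)/(2a+1)^2, so \<open>cheb_ratio\<close>
  and \<open>central_binomial_Suc\<close> give the step. The zeros m = 0, ..., a-1 are those of the
  binomials in \<open>cheb\<close>.\<close>

lemma cheb_prod:
  "cheb m a = of_nat ((2 * a) choose a) / (16 ^ a * (2 * of_nat a + 1)) *
     (\<Prod>l<a. 1 - (2 * of_nat m + 1)\<^sup>2 / (2 * of_nat l + 1)\<^sup>2) * (2 * of_nat m + 1)"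
proof (induction a)
  case (Suc a)
  define r s where "r = (of_nat a :: rat)" and "s = (of_nat m :: rat)"
  define P where "P = (\<Prod>l<a. 1 - (2 * s + 1)\<^sup>2 / (2 * of_nat l + 1)\<^sup>2)"
  define B B' where "B = (of_nat ((2 * a) choose a) :: rat)"
    and "B' = (of_nat ((2 * Suc a) choose Suc a) :: rat)"
  have r: "r \<ge> 0" by (simp add: r_def)
  hence nz: "2 * r + 1 \<noteq> 0" "r + 1 \<noteq> 0" "2 * r + 3 \<noteq> 0" "(2 * r + 2) * (2 * r + 3) \<noteq> 0"
    by (auto simp: add_nonneg_eq_0_iff)
  have B': "B' = 2 * (2 * r + 1) * B / (r + 1)"
    using central_binomial_Suc[of a] nz
    by (simp add: B_def B'_def r_def field_simps del: binomial_Suc_Suc mult_Suc_right mult_Suc)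
  have "cheb m (Suc a) = (r - s) * (r + s + 1) * cheb m a / ((2 * r + 2) * (2 * r + 3))"
    using cheb_ratio[of a m] nz(4) by (simp add: r_def s_def nonzero_eq_divide_eq mult_ac)
  also have "cheb m a = B / (16 ^ a * (2 * r + 1)) * P * (2 * s + 1)"
    unfolding Suc B_def r_def P_def s_def ..
  also have "(r - s) * (r + s + 1) * (B / (16 ^ a * (2 * r + 1)) * P * (2 * s + 1)) / ((2 * r + 2) * (2 * r + 3))
      = B' / (16 ^ Suc a * (2 * r + 3)) * (P * (1 - (2 * s + 1)\<^sup>2 / (2 * r + 1)\<^sup>2)) * (2 * s + 1)"
  proof -
    have "1 - (2 * s + 1)\<^sup>2 / (2 * r + 1)\<^sup>2 = 4 * ((r - s) * (r + s + 1)) / (2 * r + 1)\<^sup>2"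
      using nz by (simp add: field_simps) (simp add: algebra_simps power2_eq_square)
    moreover have "(2 * r + 2) = 2 * (r + 1)" by simp
    ultimately show ?thesis
      unfolding B' using nz(1-3) by (simp add: divide_simps power2_eq_square) (simp add: algebra_simps)
  qed
  finally show ?case
    by (simp add: B'_def r_def s_def P_def add_ac del: binomial_Suc_Suc mult_Suc_right mult_Suc)
qed simp

section \<open>Derivatives of the cube of the eta function\<close>

definition weight_set :: "nat \<Rightarrow> (nat \<times> nat \<times> nat) set" where
  "weight_set t = {(\<alpha>, \<beta>, \<gamma>). \<alpha> + 2 * \<beta> + 3 * \<gamma> = t}"

definition eis_monom :: "nat \<Rightarrow> nat \<Rightarrow> nat \<Rightarrow> rat fps" where
  "eis_monom \<alpha> \<beta> \<gamma> = E2 ^ \<alpha> * E4 ^ \<beta> * E6 ^ \<gamma>"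

text \<open>Equals \<open>(- 8) ^ t * D ^ t (eta ^ 3) / eta ^ 3\<close> with \<open>D = q * d/dq\<close> and Dedekind's eta.\<close>
definition eis_poly :: "nat \<Rightarrow> rat fps" where
  "eis_poly t = (\<Sum>(\<alpha>, \<beta>, \<gamma>)\<in>weight_set t.
     fps_const (coeff_c (int \<alpha>) (int \<beta>) (int \<gamma>)) * eis_monom \<alpha> \<beta> \<gamma>)"

lemma finite_weight_set: "finite (weight_set t)"
  unfolding weight_set_def by (rule finite_weight)

lemma fps_XD_mult: "fps_XD (f * g) = fps_XD f * g + f * (fps_XD g :: rat fps)"
  by (simp add: fps_XD_def algebra_simps)

lemma fps_XD_mult_const_right: "fps_XD (f * fps_const c) = fps_const c * (fps_XD f :: rat fps)"
  using fps_XD_mult_const[of c f] by (simp add: mult.commute)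

lemma fps_XD_power: "fps_XD (f ^ n) = of_nat n * f ^ (n - 1) * (fps_XD f :: rat fps)"
  by (simp add: fps_XD_def fps_deriv_power' mult_ac)

lemma fps_XD_sum: "fps_XD (\<Sum>x\<in>A. f x) = (\<Sum>x\<in>A. fps_XD (f x) :: rat fps)"
  by (simp add: fps_XD_def fps_deriv_sum sum_distrib_left)

text \<open>Multiplied by 24, Ramanujan's equations with denominators 12, 3, 2 yield the
  coefficients 2, 8, 12 of the recursion for \<open>coeff_c\<close>.\<close>

lemma fps_XD_eis_monom:
  "24 * fps_XD (eis_monom \<alpha> \<beta> \<gamma>) =
     of_nat (2 * \<alpha> + 8 * \<beta> + 12 * \<gamma>) * eis_monom (Suc \<alpha>) \<beta> \<gamma>
     - of_nat (2 * \<alpha>) * eis_monom (\<alpha> - 1) (Suc \<beta>) \<gamma>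
     - of_nat (8 * \<beta>) * eis_monom \<alpha> (\<beta> - 1) (Suc \<gamma>)
     - of_nat (12 * \<gamma>) * eis_monom \<alpha> (\<beta> + 2) (\<gamma> - 1)"
proof -
  \<comment> \<open>For n = 0 both sides vanish, so the truncated exponent n - 1 does no
    harm.\<close>
  have p: "of_nat (k * n) * f ^ (n - 1) * f = of_nat (k * n) * f ^ n" for k n and f :: "rat fps"
    by (cases n) (simp_all add: mult_ac)
  have 2: "24 * (E4 ^ \<beta> * E6 ^ \<gamma> * fps_XD (E2 ^ \<alpha>)) =
      of_nat (2 * \<alpha>) * (E2 ^ (\<alpha> - 1) * (12 * fps_XD E2)) * (E4 ^ \<beta> * E6 ^ \<gamma>)"
    by (simp add: fps_XD_power mult_ac)
  have 4: "24 * (E2 ^ \<alpha> * E6 ^ \<gamma> * fps_XD (E4 ^ \<beta>)) =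
      of_nat (8 * \<beta>) * (E4 ^ (\<beta> - 1) * (3 * fps_XD E4)) * (E2 ^ \<alpha> * E6 ^ \<gamma>)"
    by (simp add: fps_XD_power mult_ac)
  have 6: "24 * (E2 ^ \<alpha> * E4 ^ \<beta> * fps_XD (E6 ^ \<gamma>)) =
      of_nat (12 * \<gamma>) * (E6 ^ (\<gamma> - 1) * (2 * fps_XD E6)) * (E2 ^ \<alpha> * E4 ^ \<beta>)"
    by (simp add: fps_XD_power mult_ac)
  have "24 * fps_XD (eis_monom \<alpha> \<beta> \<gamma>) =
      24 * (E4 ^ \<beta> * E6 ^ \<gamma> * fps_XD (E2 ^ \<alpha>)) + 24 * (E2 ^ \<alpha> * E6 ^ \<gamma> * fps_XD (E4 ^ \<beta>))
      + 24 * (E2 ^ \<alpha> * E4 ^ \<beta> * fps_XD (E6 ^ \<gamma>))"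
    by (simp add: eis_monom_def fps_XD_mult algebra_simps)
  also have "\<dots> = (of_nat (2 * \<alpha>) * E2 ^ (\<alpha> - 1) * E2) * (E2 * E4 ^ \<beta> * E6 ^ \<gamma>)
     - of_nat (2 * \<alpha>) * (E2 ^ (\<alpha> - 1) * E4) * (E4 ^ \<beta> * E6 ^ \<gamma>)
     + (of_nat (8 * \<beta>) * E4 ^ (\<beta> - 1) * E4) * (E2 * E2 ^ \<alpha> * E6 ^ \<gamma>)
     - of_nat (8 * \<beta>) * (E4 ^ (\<beta> - 1) * E6) * (E2 ^ \<alpha> * E6 ^ \<gamma>)
     + (of_nat (12 * \<gamma>) * E6 ^ (\<gamma> - 1) * E6) * (E2 * E2 ^ \<alpha> * E4 ^ \<beta>)
     - of_nat (12 * \<gamma>) * (E6 ^ (\<gamma> - 1) * E4\<^sup>2) * (E2 ^ \<alpha> * E4 ^ \<beta>)"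
    unfolding 2 4 6 ramanujan_E2 ramanujan_E4 ramanujan_E6 by (simp add: algebra_simps power2_eq_square)
  also have "of_nat (2 * \<alpha>) * E2 ^ (\<alpha> - 1) * E2 = of_nat (2 * \<alpha>) * E2 ^ \<alpha>"
    by (rule p)
  also have "of_nat (8 * \<beta>) * E4 ^ (\<beta> - 1) * E4 = of_nat (8 * \<beta>) * E4 ^ \<beta>"
    by (rule p)
  also have "of_nat (12 * \<gamma>) * E6 ^ (\<gamma> - 1) * E6 = of_nat (12 * \<gamma>) * E6 ^ \<gamma>"
    by (rule p)
  finally show ?thesis
    by (simp add: eis_monom_def algebra_simps power2_eq_square)
qed

lemma coeff_c_neg: "\<alpha> < 0 \<or> \<beta> < 0 \<or> \<gamma> < 0 \<Longrightarrow> coeff_c \<alpha> \<beta> \<gamma> = 0"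
  by (subst coeff_c.simps) auto

lemma coeff_c_rec:
  assumes "\<alpha> + 2 * \<beta> + 3 * \<gamma> = Suc t"
  shows "coeff_c (int \<alpha>) (int \<beta>) (int \<gamma>) =
     - (1 / 3) * of_nat (2 * \<alpha> + 8 * \<beta> + 12 * \<gamma> + 1) * coeff_c (int \<alpha> - 1) (int \<beta>) (int \<gamma>)
     + (2 / 3) * of_nat (\<alpha> + 1) * coeff_c (int \<alpha> + 1) (int \<beta> - 1) (int \<gamma>)
     + (8 / 3) * of_nat (\<beta> + 1) * coeff_c (int \<alpha>) (int \<beta> + 1) (int \<gamma> - 1)
     + 4 * of_nat (\<gamma> + 1) * coeff_c (int \<alpha>) (int \<beta> - 2) (int \<gamma> + 1)"
  using assms by (subst coeff_c.simps) (auto simp: add_ac)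

text \<open>Shifting exponents is a bijection only between the triples where no subtraction is
  truncated. On the others the terms are 0, by a negative argument of \<open>coeff_c\<close> on one
  side and by a factor such as \<alpha> = 0 on the other.\<close>

lemma sum_reindex_neutral:
  assumes "finite S" "finite T"
    and "\<And>x. x \<in> S \<Longrightarrow> P x \<Longrightarrow> i (j x) = x \<and> j x \<in> T \<and> Q (j x) \<and> h (j x) = g x"
    and "\<And>y. y \<in> T \<Longrightarrow> Q y \<Longrightarrow> j (i y) = y \<and> i y \<in> S \<and> P (i y)"
    and "\<And>x. x \<in> S \<Longrightarrow> \<not> P x \<Longrightarrow> g x = 0" "\<And>y. y \<in> T \<Longrightarrow> \<not> Q y \<Longrightarrow> h y = 0"
  shows "sum g S = sum h T"
proof -
  have "sum g S = sum g {x \<in> S. P x}"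
    using assms(1,5) by (intro sum.mono_neutral_right) auto
  also have "\<dots> = sum h {y \<in> T. Q y}"
    by (rule sum.reindex_bij_witness[of _ i j]) (use assms(3,4) in auto)
  also have "\<dots> = sum h T"
    using assms(2,6) by (intro sum.mono_neutral_left) auto
  finally show ?thesis .
qed

lemma eis_poly_0: "eis_poly 0 = 1"
proof -
  have "weight_set 0 = {(0, 0, 0)}" by (auto simp: weight_set_def)
  thus ?thesis by (simp add: eis_poly_def eis_monom_def coeff_c.simps)
qed

text \<open>The recursion for \<open>coeff_c\<close> collects contributions by target monomial, the
  derivative by source monomial; the four sums are reindexed from one form to the other.\<close>

lemma eis_poly_Suc: "eis_poly (Suc t) = - 8 * fps_XD (eis_poly t) - E2 * eis_poly t"
proof -
  define c where "c = (\<lambda>\<alpha> \<beta> \<gamma>. coeff_c (int \<alpha>) (int \<beta>) (int \<gamma>))"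
  define S T where "S = weight_set (Suc t)" and "T = weight_set t"
  have fin: "finite S" "finite T" by (simp_all add: S_def T_def finite_weight_set)
  \<comment> \<open>Replacing \<alpha> by \<alpha> + 1 turns the constant 1 into 3, and -(1/3) * 3 =
    -1 accounts for the term - E2 * \<open>eis_poly t\<close>.\<close>
  have s1: "(\<Sum>(\<alpha>, \<beta>, \<gamma>)\<in>S. fps_const (- (1 / 3) * of_nat (2 * \<alpha> + 8 * \<beta> + 12 * \<gamma> + 1) *
        coeff_c (int \<alpha> - 1) (int \<beta>) (int \<gamma>)) * eis_monom \<alpha> \<beta> \<gamma>) =
     (\<Sum>(\<alpha>, \<beta>, \<gamma>)\<in>T. fps_const (- (1 / 3) * of_nat (2 * \<alpha> + 8 * \<beta> + 12 * \<gamma> + 3) * c \<alpha> \<beta> \<gamma>) *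
        eis_monom (Suc \<alpha>) \<beta> \<gamma>)"
    by (rule sum_reindex_neutral[OF fin, where P = "\<lambda>(\<alpha>, \<beta>, \<gamma>). \<alpha> > 0" and Q = "\<lambda>_. True" and
          j = "\<lambda>(\<alpha>, \<beta>, \<gamma>). (\<alpha> - 1, \<beta>, \<gamma>)" and i = "\<lambda>(\<alpha>, \<beta>, \<gamma>). (\<alpha> + 1, \<beta>, \<gamma>)"])
      (auto simp: S_def T_def weight_set_def c_def coeff_c_neg of_nat_diff Suc_le_eq add_ac
        simp del: add_2_eq_Suc add_2_eq_Suc')
  have s2: "(\<Sum>(\<alpha>, \<beta>, \<gamma>)\<in>S. fps_const ((2 / 3) * of_nat (\<alpha> + 1) *
        coeff_c (int \<alpha> + 1) (int \<beta> - 1) (int \<gamma>)) * eis_monom \<alpha> \<beta> \<gamma>) =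
     (\<Sum>(\<alpha>, \<beta>, \<gamma>)\<in>T. fps_const ((2 / 3) * of_nat \<alpha> * c \<alpha> \<beta> \<gamma>) * eis_monom (\<alpha> - 1) (Suc \<beta>) \<gamma>)"
    by (rule sum_reindex_neutral[OF fin, where P = "\<lambda>(\<alpha>, \<beta>, \<gamma>). \<beta> > 0" and Q = "\<lambda>(\<alpha>, \<beta>, \<gamma>). \<alpha> > 0" and
          j = "\<lambda>(\<alpha>, \<beta>, \<gamma>). (\<alpha> + 1, \<beta> - 1, \<gamma>)" and i = "\<lambda>(\<alpha>, \<beta>, \<gamma>). (\<alpha> - 1, \<beta> + 1, \<gamma>)"])
      (auto simp: S_def T_def weight_set_def c_def coeff_c_neg of_nat_diff Suc_le_eq add_ac
        simp del: add_2_eq_Suc add_2_eq_Suc')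
  have s3: "(\<Sum>(\<alpha>, \<beta>, \<gamma>)\<in>S. fps_const ((8 / 3) * of_nat (\<beta> + 1) *
        coeff_c (int \<alpha>) (int \<beta> + 1) (int \<gamma> - 1)) * eis_monom \<alpha> \<beta> \<gamma>) =
     (\<Sum>(\<alpha>, \<beta>, \<gamma>)\<in>T. fps_const ((8 / 3) * of_nat \<beta> * c \<alpha> \<beta> \<gamma>) * eis_monom \<alpha> (\<beta> - 1) (Suc \<gamma>))"
    by (rule sum_reindex_neutral[OF fin, where P = "\<lambda>(\<alpha>, \<beta>, \<gamma>). \<gamma> > 0" and Q = "\<lambda>(\<alpha>, \<beta>, \<gamma>). \<beta> > 0" and
          j = "\<lambda>(\<alpha>, \<beta>, \<gamma>). (\<alpha>, \<beta> + 1, \<gamma> - 1)" and i = "\<lambda>(\<alpha>, \<beta>, \<gamma>). (\<alpha>, \<beta> - 1, \<gamma> + 1)"])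
      (auto simp: S_def T_def weight_set_def c_def coeff_c_neg of_nat_diff Suc_le_eq add_ac
        simp del: add_2_eq_Suc add_2_eq_Suc')
  have s4: "(\<Sum>(\<alpha>, \<beta>, \<gamma>)\<in>S. fps_const (4 * of_nat (\<gamma> + 1) *
        coeff_c (int \<alpha>) (int \<beta> - 2) (int \<gamma> + 1)) * eis_monom \<alpha> \<beta> \<gamma>) =
     (\<Sum>(\<alpha>, \<beta>, \<gamma>)\<in>T. fps_const (4 * of_nat \<gamma> * c \<alpha> \<beta> \<gamma>) * eis_monom \<alpha> (\<beta> + 2) (\<gamma> - 1))"
    by (rule sum_reindex_neutral[OF fin, where P = "\<lambda>(\<alpha>, \<beta>, \<gamma>). \<beta> \<ge> 2" and Q = "\<lambda>(\<alpha>, \<beta>, \<gamma>). \<gamma> > 0" and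
          j = "\<lambda>(\<alpha>, \<beta>, \<gamma>). (\<alpha>, \<beta> - 2, \<gamma> + 1)" and i = "\<lambda>(\<alpha>, \<beta>, \<gamma>). (\<alpha>, \<beta> + 2, \<gamma> - 1)"])
      (auto simp: S_def T_def weight_set_def c_def coeff_c_neg of_nat_diff Suc_le_eq add_ac
        simp del: add_2_eq_Suc add_2_eq_Suc')
  have "eis_poly (Suc t) = (\<Sum>(\<alpha>, \<beta>, \<gamma>)\<in>S.
       fps_const (- (1 / 3) * of_nat (2 * \<alpha> + 8 * \<beta> + 12 * \<gamma> + 1) *
         coeff_c (int \<alpha> - 1) (int \<beta>) (int \<gamma>)) * eis_monom \<alpha> \<beta> \<gamma>
     + fps_const ((2 / 3) * of_nat (\<alpha> + 1) *
         coeff_c (int \<alpha> + 1) (int \<beta> - 1) (int \<gamma>)) * eis_monom \<alpha> \<beta> \<gamma>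
     + fps_const ((8 / 3) * of_nat (\<beta> + 1) *
         coeff_c (int \<alpha>) (int \<beta> + 1) (int \<gamma> - 1)) * eis_monom \<alpha> \<beta> \<gamma>
     + fps_const (4 * of_nat (\<gamma> + 1) *
         coeff_c (int \<alpha>) (int \<beta> - 2) (int \<gamma> + 1)) * eis_monom \<alpha> \<beta> \<gamma>)"
    unfolding eis_poly_def S_def[symmetric]
  proof (rule sum.cong[OF refl], clarify)
    fix \<alpha> \<beta> \<gamma> assume "(\<alpha>, \<beta>, \<gamma>) \<in> S"
    hence "\<alpha> + 2 * \<beta> + 3 * \<gamma> = Suc t" by (simp add: S_def weight_set_def)
    note r = coeff_c_rec[OF this]
    show "fps_const (coeff_c (int \<alpha>) (int \<beta>) (int \<gamma>)) * eis_monom \<alpha> \<beta> \<gamma> =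
       fps_const (- (1 / 3) * of_nat (2 * \<alpha> + 8 * \<beta> + 12 * \<gamma> + 1) *
         coeff_c (int \<alpha> - 1) (int \<beta>) (int \<gamma>)) * eis_monom \<alpha> \<beta> \<gamma>
     + fps_const ((2 / 3) * of_nat (\<alpha> + 1) *
         coeff_c (int \<alpha> + 1) (int \<beta> - 1) (int \<gamma>)) * eis_monom \<alpha> \<beta> \<gamma>
     + fps_const ((8 / 3) * of_nat (\<beta> + 1) *
         coeff_c (int \<alpha>) (int \<beta> + 1) (int \<gamma> - 1)) * eis_monom \<alpha> \<beta> \<gamma>
     + fps_const (4 * of_nat (\<gamma> + 1) *
         coeff_c (int \<alpha>) (int \<beta> - 2) (int \<gamma> + 1)) * eis_monom \<alpha> \<beta> \<gamma>"
      unfolding r fps_const_add[symmetric] distrib_right ..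
  qed
  also have "\<dots> = (\<Sum>(\<alpha>, \<beta>, \<gamma>)\<in>T.
       fps_const (- (1 / 3) * of_nat (2 * \<alpha> + 8 * \<beta> + 12 * \<gamma> + 3) * c \<alpha> \<beta> \<gamma>) * eis_monom (Suc \<alpha>) \<beta> \<gamma>
     + fps_const ((2 / 3) * of_nat \<alpha> * c \<alpha> \<beta> \<gamma>) * eis_monom (\<alpha> - 1) (Suc \<beta>) \<gamma>
     + fps_const ((8 / 3) * of_nat \<beta> * c \<alpha> \<beta> \<gamma>) * eis_monom \<alpha> (\<beta> - 1) (Suc \<gamma>)
     + fps_const (4 * of_nat \<gamma> * c \<alpha> \<beta> \<gamma>) * eis_monom \<alpha> (\<beta> + 2) (\<gamma> - 1))"
    using s1 s2 s3 s4 unfolding case_prod_unfold sum.distrib by (simp only:)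
  also have "\<dots> = (\<Sum>(\<alpha>, \<beta>, \<gamma>)\<in>T. fps_const (c \<alpha> \<beta> \<gamma>) *
       (- 8 * fps_XD (eis_monom \<alpha> \<beta> \<gamma>) - E2 * eis_monom \<alpha> \<beta> \<gamma>))"
  proof (rule sum.cong[OF refl], clarify)
    fix \<alpha> \<beta> \<gamma>
    define M1 M2 M3 M4 where "M1 = eis_monom (Suc \<alpha>) \<beta> \<gamma>" and "M2 = eis_monom (\<alpha> - 1) (Suc \<beta>) \<gamma>"
      and "M3 = eis_monom \<alpha> (\<beta> - 1) (Suc \<gamma>)" and "M4 = eis_monom \<alpha> (\<beta> + 2) (\<gamma> - 1)"
    have E2: "E2 * eis_monom \<alpha> \<beta> \<gamma> = M1" by (simp add: M1_def eis_monom_def mult_ac)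
    have third: "3 * fps_const (1 / 3) = (1 :: rat fps)"
      by (simp add: numeral_fps_const)
    have "- 8 * fps_XD (eis_monom \<alpha> \<beta> \<gamma>) = - fps_const (1 / 3) * (24 * fps_XD (eis_monom \<alpha> \<beta> \<gamma>))"
      using third by algebra
    also have "\<dots> = fps_const (- (1 / 3)) * (of_nat (2 * \<alpha> + 8 * \<beta> + 12 * \<gamma>) * M1
         - of_nat (2 * \<alpha>) * M2 - of_nat (8 * \<beta>) * M3 - of_nat (12 * \<gamma>) * M4)"
      unfolding fps_XD_eis_monom M1_def M2_def M3_def M4_def by simp
    finally have D: "- 8 * fps_XD (eis_monom \<alpha> \<beta> \<gamma>) = fps_const (- (1 / 3)) *
        (of_nat (2 * \<alpha> + 8 * \<beta> + 12 * \<gamma>) * M1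
         - of_nat (2 * \<alpha>) * M2 - of_nat (8 * \<beta>) * M3 - of_nat (12 * \<gamma>) * M4)" .
    show "fps_const (- (1 / 3) * of_nat (2 * \<alpha> + 8 * \<beta> + 12 * \<gamma> + 3) * c \<alpha> \<beta> \<gamma>) * eis_monom (Suc \<alpha>) \<beta> \<gamma>
     + fps_const ((2 / 3) * of_nat \<alpha> * c \<alpha> \<beta> \<gamma>) * eis_monom (\<alpha> - 1) (Suc \<beta>) \<gamma>
     + fps_const ((8 / 3) * of_nat \<beta> * c \<alpha> \<beta> \<gamma>) * eis_monom \<alpha> (\<beta> - 1) (Suc \<gamma>)
     + fps_const (4 * of_nat \<gamma> * c \<alpha> \<beta> \<gamma>) * eis_monom \<alpha> (\<beta> + 2) (\<gamma> - 1)
     = fps_const (c \<alpha> \<beta> \<gamma>) * (- 8 * fps_XD (eis_monom \<alpha> \<beta> \<gamma>) - E2 * eis_monom \<alpha> \<beta> \<gamma>)"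
      unfolding D E2 M1_def[symmetric] M2_def[symmetric] M3_def[symmetric] M4_def[symmetric]
      by (rule fps_ext) (simp add: algebra_simps fps_of_nat[symmetric] numeral_fps_const)
  qed
  also have "\<dots> = - 8 * fps_XD (eis_poly t) - E2 * eis_poly t"
    unfolding eis_poly_def T_def[symmetric] fps_XD_sum
    by (simp add: c_def case_prod_unfold sum_distrib_left sum_subtractf[symmetric] algebra_simps sum_negf[symmetric]
        fps_XD_mult_const_right)
  finally show ?thesis .
qed

text \<open>Without the factor q^(1/8), the operator -8 q d/dq becomes -8 q d/dq - 1, with
  eigenvalue -8 tri m - 1 = -(2m+1)^2 on q^(tri m).\<close>

lemma eis_poly_eta3:
  "eis_poly t * eta3 = tri_series (\<lambda>m. (- ((2 * of_nat m + 1)\<^sup>2)) ^ t * ((- 1) ^ m * (2 * of_nat m + 1)))"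
proof (induction t)
  case (Suc t)
  define g where "g = (\<lambda>m. (- ((2 * of_nat m + 1)\<^sup>2)) ^ t * ((- 1) ^ m * (2 * of_nat m + 1)) :: rat)"
  have tri: "- 8 * of_nat (tri m) - 1 = - ((2 * of_nat m + 1 :: rat)\<^sup>2)" for m
  proof -
    have "2 * of_nat (tri m) = (of_nat m * (of_nat m + 1) :: rat)"
      using arg_cong[OF two_tri[of m], of "of_nat :: nat \<Rightarrow> rat"] by (simp add: algebra_simps)
    thus ?thesis by algebra
  qed
  \<comment> \<open>By the product rule the derivative of \<open>eta3\<close> contributes -(E2 - 1),
    and the - 1 of the operator leaves -E2.\<close>
  have "eis_poly (Suc t) * eta3 = - 8 * fps_XD (eis_poly t * eta3) - eis_poly t * eta3"
    using fps_XD_eta3 unfolding eis_poly_Suc fps_XD_mult by algebra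
  also have "\<dots> = fps_const (- 8) * fps_XD (tri_series g) - tri_series g"
    unfolding Suc g_def[symmetric] by (simp add: numeral_fps_const)
  also have "\<dots> = tri_series (\<lambda>m. (- 8 * of_nat (tri m) - 1) * g m)"
    by (simp add: fps_XD_tri_series tri_series_const tri_series_diff algebra_simps)
  finally show ?case unfolding tri by (simp add: g_def mult_ac)
qed (simp add: eis_poly_0 eta3_def)

theorem theorem1p3:
  fixes a :: nat
  shows "macmahon_U a =
    (\<Sum>t = 0..a. fps_const (weight_w t a) *
      (\<Sum>(\<alpha>, \<beta>, \<gamma>) \<in> {(\<alpha>, \<beta>, \<gamma>). \<alpha> + 2 * \<beta> + 3 * \<gamma> = t}.
         fps_const (coeff_c (int \<alpha>) (int \<beta>) (int \<gamma>)) * E2 ^ \<alpha> * E4 ^ \<beta> * E6 ^ \<gamma>))"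
proof -
  \<comment> \<open>At y = -(2m+1)^2 the product in \<open>weight_w_sum\<close> is the one in
    \<open>cheb_prod\<close>.\<close>
  have w: "(\<Sum>t=0..a. weight_w t a * ((- ((2 * of_nat m + 1)\<^sup>2)) ^ t * ((- 1) ^ m * (2 * of_nat m + 1))))
      = (- 1) ^ m * cheb m a" for m
  proof -
    have "(\<Sum>t=0..a. weight_w t a * ((- ((2 * of_nat m + 1)\<^sup>2)) ^ t * ((- 1) ^ m * (2 * of_nat m + 1))))
       = (- 1) ^ m * ((\<Sum>t=0..a. weight_w t a * (- ((2 * of_nat m + 1)\<^sup>2)) ^ t) * (2 * of_nat m + 1))"
      by (simp add: sum_distrib_left sum_distrib_right mult_ac)
    thus ?thesis unfolding weight_w_sum cheb_prod[of m a] by simp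
  qed
  have "(\<Sum>t=0..a. fps_const (weight_w t a) * eis_poly t) * eta3 =
      (\<Sum>t=0..a. fps_const (weight_w t a) * (eis_poly t * eta3))"
    by (simp add: sum_distrib_right mult.assoc)
  also have "\<dots> = tri_series (\<lambda>m. (- 1) ^ m * cheb m a)"
    unfolding eis_poly_eta3 tri_series_const tri_series_sum w ..
  also have "\<dots> = macmahon_U a * eta3"
    using macmahon_U_tri_series[of a] by (simp add: eta3_def)
  \<comment> \<open>Rational power series form an integral domain, so \<open>eta3\<close>
    cancels.\<close>
  finally have "macmahon_U a = (\<Sum>t=0..a. fps_const (weight_w t a) * eis_poly t)"
    using eta3_neq_0 by simp
  thus ?thesis
    by (simp add: eis_poly_def eis_monom_def weight_set_def mult.assoc)
qed

end
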